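(* Let $0<\alpha<2$, $H>0$, and let $\mathbf{X}=\{X(t)\}_{t\in\mathbb{R}^d}$ be a real-valued $H$-self-similar $S\alpha S$ random field with stationary increments and integral representation $$X(t)\stackrel{d}{=}\int_E f_t(s)\,M(ds),\qquad t\in\mathbb{R}^d,$$ where $M$ is an $S\alpha S$ random measure on a measurable space $(E,\mathcal{E})$ with $\sigma$-finite control measure $m$ and $f_t\in L^\alpha(E,m)$ for all $t\in\mathbb{R}^d$. Let $V=\{-1,0,1\}^d\setminus\{\mathbf{0}\}$ and, for $v\in V$, $Y^{(v)}(t)=X(t+v)-X(t)$. If for every $v\in V$ the increment field $\{Y^{(v)}(t)\}_{t\in\mathbb{Z}^d}$ has effective dimension $p\le d$, and $\alpha>\frac{p}{H}$, then for any $0<\gamma<\alpha$, with $T=[0,1]^d$, $$\limsup_{h\to0+}\ \frac{\sup_{t\in T}\ \sup_{s\in T,\ |s-t|_\infty\le h}|X(t)-X(s)|}{h^{H-p/\alpha}\,(\log(1/h))^{1/\gamma}}=0\qquad\text{almost surely},$$ where $|s-t|_\infty=\max_{1\le j\le d}|s_j-t_j|$.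
   Context: $d\ge1$ is an integer, $\mathbf{0}=(0,\dots,0)$. $\stackrel{d}{=}$ between fields means equality of finite-dimensional distributions. As usual for almost sure statements about suprema over uncountable sets, $\mathbf{X}$ is taken to be a separable version. A real-valued field is $S\alpha S$ (symmetric $\alpha$-stable) if every finite linear combination of its values has a symmetric $\alpha$-stable distribution. An $S\alpha S$ random measure $M$ with $\sigma$-finite control measure $m$ is an independently scattered, $\sigma$-additive random set function on sets of finite $m$-measure with $\mathbb{E}e^{i\theta M(A)}=e^{-|\theta|^\alpha m(A)}$; for $g\in L^\alpha(E,m)$, $\mathbb{E}\exp(i\theta\int g\,dM)=\exp(-|\theta|^\alpha\int|g|^\alpha dm)$. $\{X(t)\}_{t\in\mathbb{R}^d}$ is $H$-self-similar ($H>0$) if $\{X(ct)\}\stackrel{d}{=}\{c^HX(t)\}$ for all $c>0$; it has stationary increments if $\{X(t+u)-X(u)\}_{t\in\mathbb{R}^d}\stackrel{d}{=}\{X(t)-X(0)\}_{t\in\mathbb{R}^d}$ for each $u\in\mathbb{R}^d$. Then each $\{Y^{(v)}(t)\}_{t\in\mathbb{Z}^d}$ is a stationary $S\alpha S$ random field. A nonsingular $\mathbb{Z}^d$-action $\{\phi_t\}_{t\in\mathbb{Z}^d}$ on a $\sigma$-finite standard measure space $(S,\mathcal{S},\mu)$: each $\phi_t:S\to S$ is measurable, $\phi_0=\mathrm{id}_S$, $\phi_{u+v}=\phi_u\circ\phi_v$, each $\mu\circ\phi_t$ is equivalent to $\mu$. A $\{\pm1\}$-valued measurable cocycle: measurable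 maps $c_t:S\to\{\pm1\}$ with $c_{u+v}(s)=c_u(\phi_v(s))c_v(s)$. A stationary $S\alpha S$ field $\{Y(t)\}_{t\in\mathbb{Z}^d}$ is generated by the action $\{\phi_t\}$ if $Y(t)\stackrel{d}{=}\int_S c_t(s)\left(\frac{d\mu\circ\phi_t}{d\mu}(s)\right)^{1/\alpha}f\circ\phi_t(s)\,N(ds)$, $t\in\mathbb{Z}^d$, for some $f\in L^\alpha(S,\mu)$, some such cocycle, and an $S\alpha S$ random measure $N$ with control measure $\mu$, with $\bigcup_t\mathrm{Support}(f\circ\phi_t)=S$. (Every stationary $S\alpha S$ field indexed by $\mathbb{Z}^d$ has such a representation.) Effective dimension. Let $A=\{\phi_t:t\in\mathbb{Z}^d\}$, a group of invertible nonsingular transformations of $(S,\mu)$, and $\Phi:\mathbb{Z}^d\to A$, $\Phi(t)=\phi_t$. Then $A\cong\mathbb{Z}^d/\mathrm{Ker}(\Phi)$ and $A=\bar F\oplus\bar N$ with $\bar F$ free abelian and $\bar N$ finite; assume $p=\mathrm{rank}(\bar F)\ge1$. Choose an injective homomorphism $\Psi:\bar F\to\mathbb{Z}^d$ with $\Phi\circ\Psi=1_{\bar F}$ and let $F=\Psi(\bar F)$, a free subgroup of $\mathbb{Z}^d$ of rank $p$. The field generated by $\{\phi_t\}$ has effective dimension $p$ if the restricted action $\{\phi_t\}_{t\in F}$ is not conservative, i.e. there is a measurable $W\subseteq S$ with $\mu(W)>0$ such that $\{\phi_t(W):t\in F\}$ is a pairwise disjoint collection. *)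

theory Defs
  imports "HOL-Probability.Probability" "HOL-Algebra.Bij" "HOL-Algebra.Free_Abelian_Groups"
begin

section \<open>Random fields\<close>

definition random_field :: "'w measure \<Rightarrow> ('i \<Rightarrow> 'w \<Rightarrow> real) \<Rightarrow> bool" where
  "random_field P X \<longleftrightarrow> prob_space P \<and> (\<forall>i. X i \<in> borel_measurable P)"

definition eq_fdd ::
  "'w measure \<Rightarrow> ('i \<Rightarrow> 'w \<Rightarrow> real) \<Rightarrow> 'v measure \<Rightarrow> ('i \<Rightarrow> 'v \<Rightarrow> real) \<Rightarrow> bool" where
  "eq_fdd P X Q Y \<longleftrightarrow> random_field P X \<and> random_field Q Y \<and>
     (\<forall>J. finite J \<longrightarrow>
        distr P (\<Pi>\<^sub>M i\<in>J. borel) (\<lambda>\<omega>. \<lambda>i\<in>J. X i \<omega>) =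
        distr Q (\<Pi>\<^sub>M i\<in>J. borel) (\<lambda>\<omega>. \<lambda>i\<in>J. Y i \<omega>))"

text \<open>The degenerate law (scale \<open>\<sigma> = 0\<close>) counts as symmetric stable.\<close>

definition sas_distribution :: "real \<Rightarrow> real measure \<Rightarrow> bool" where
  "sas_distribution \<alpha> N \<longleftrightarrow>
     (\<exists>\<sigma>\<ge>0. \<forall>\<theta>. char N \<theta> = complex_of_real (exp (- (\<sigma> powr \<alpha> * \<bar>\<theta>\<bar> powr \<alpha>))))"

definition sas_field :: "real \<Rightarrow> 'w measure \<Rightarrow> ('i \<Rightarrow> 'w \<Rightarrow> real) \<Rightarrow> bool" where
  "sas_field \<alpha> P X \<longleftrightarrow> random_field P X \<and>
     (\<forall>J a. finite J \<longrightarrow> sas_distribution \<alpha> (distr P borel (\<lambda>\<omega>. \<Sum>i\<in>J. a i * X i \<omega>)))"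

definition self_similar :: "real \<Rightarrow> 'w measure \<Rightarrow> (real ^ 'd \<Rightarrow> 'w \<Rightarrow> real) \<Rightarrow> bool" where
  "self_similar H P X \<longleftrightarrow>
     (\<forall>c>0. eq_fdd P (\<lambda>t. X (c *\<^sub>R t)) P (\<lambda>t \<omega>. c powr H * X t \<omega>))"

definition stationary_increments :: "'w measure \<Rightarrow> (real ^ 'd \<Rightarrow> 'w \<Rightarrow> real) \<Rightarrow> bool" where
  "stationary_increments P X \<longleftrightarrow>
     (\<forall>u. eq_fdd P (\<lambda>t \<omega>. X (t + u) \<omega> - X u \<omega>) P (\<lambda>t \<omega>. X t \<omega> - X 0 \<omega>))"

text \<open>Separability in the sense of Doob, with separating set \<open>D\<close>. Taking \<open>C = {}\<close> shows that
  \<open>D\<close> is dense.\<close>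

definition separable_field ::
  "'w measure \<Rightarrow> ('t::topological_space \<Rightarrow> 'w \<Rightarrow> real) \<Rightarrow> bool" where
  "separable_field P X \<longleftrightarrow> (\<exists>D. countable D \<and>
     (AE \<omega> in P. \<forall>G C. open G \<and> closed C \<and> (\<forall>t\<in>G \<inter> D. X t \<omega> \<in> C) \<longrightarrow> (\<forall>t\<in>G. X t \<omega> \<in> C)))"

section \<open>Symmetric stable random measures and their integrals\<close>

text \<open>\<open>M\<close> is a random set function on the measurable space underlying \<open>m\<close>, defined on the
  probability space \<open>Q\<close>; its values on sets of infinite \<open>m\<close>-measure are irrelevant.\<close>

definition sas_random_measure ::
  "real \<Rightarrow> 'w measure \<Rightarrow> 'e measure \<Rightarrow> ('e set \<Rightarrow> 'w \<Rightarrow> real) \<Rightarrow> bool" where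
  "sas_random_measure \<alpha> Q m M \<longleftrightarrow>
     prob_space Q \<and> sigma_finite_measure m \<and>
     (\<forall>A\<in>fmeasurable m. M A \<in> borel_measurable Q \<and>
        (\<forall>\<theta>. char (distr Q borel (M A)) \<theta> =
               complex_of_real (exp (- (\<bar>\<theta>\<bar> powr \<alpha> * measure m A))))) \<and>
     (\<forall>(A :: nat \<Rightarrow> 'e set) n. A ` {..<n} \<subseteq> fmeasurable m \<and> disjoint_family_on A {..<n} \<longrightarrow>
        prob_space.indep_vars Q (\<lambda>_. borel) (\<lambda>i. M (A i)) {..<n}) \<and>
     (\<forall>A :: nat \<Rightarrow> 'e set. range A \<subseteq> fmeasurable m \<and> disjoint_family A \<and>
        (\<Union>i. A i) \<in> fmeasurable m \<longrightarrow>
        (AE \<omega> in Q. (\<lambda>i. M (A i) \<omega>) sums M (\<Union>i. A i) \<omega>))"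

definition in_Lp :: "real \<Rightarrow> 'e measure \<Rightarrow> ('e \<Rightarrow> real) \<Rightarrow> bool" where
  "in_Lp \<alpha> m g \<longleftrightarrow> g \<in> borel_measurable m \<and> integrable m (\<lambda>x. \<bar>g x\<bar> powr \<alpha>)"

definition simple_stable_integral ::
  "'e measure \<Rightarrow> ('e set \<Rightarrow> 'w \<Rightarrow> real) \<Rightarrow> ('e \<Rightarrow> real) \<Rightarrow> 'w \<Rightarrow> real" where
  "simple_stable_integral m M g \<omega> =
     (\<Sum>y\<in>g ` space m - {0}. y * M (g -` {y} \<inter> space m) \<omega>)"

text \<open>The integral \<open>\<integral>g dM\<close> of \<open>g \<in> L\<^sup>\<alpha>\<close> is the limit in probability of the integrals of simple
  functions converging to \<open>g\<close> in \<open>L\<^sup>\<alpha>\<close>. It is determined only up to \<open>Q\<close>-null sets, so it is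
  rendered as the relation ``the random variable \<open>I\<close> is a version of \<open>\<integral>g dM\<close>''.\<close>

definition has_stable_integral ::
  "real \<Rightarrow> 'w measure \<Rightarrow> 'e measure \<Rightarrow> ('e set \<Rightarrow> 'w \<Rightarrow> real) \<Rightarrow> ('e \<Rightarrow> real) \<Rightarrow> ('w \<Rightarrow> real) \<Rightarrow> bool"
where
  "has_stable_integral \<alpha> Q m M g I \<longleftrightarrow>
     in_Lp \<alpha> m g \<and> I \<in> borel_measurable Q \<and>
     (\<exists>s :: nat \<Rightarrow> 'e \<Rightarrow> real.
        (\<forall>n. simple_function m (s n) \<and> in_Lp \<alpha> m (s n)) \<and>
        (\<lambda>n. \<integral>x. \<bar>s n x - g x\<bar> powr \<alpha> \<partial>m) \<longlonglongrightarrow> 0 \<and>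
        (\<forall>\<epsilon>>0. (\<lambda>n. measure Q {\<omega> \<in> space Q. \<bar>simple_stable_integral m M (s n) \<omega> - I \<omega>\<bar> > \<epsilon>})
                  \<longlonglongrightarrow> 0))"

definition stable_integral_representation ::
  "real \<Rightarrow> 'w measure \<Rightarrow> ('i \<Rightarrow> 'w \<Rightarrow> real) \<Rightarrow>
   'v measure \<Rightarrow> 'e measure \<Rightarrow> ('e set \<Rightarrow> 'v \<Rightarrow> real) \<Rightarrow> ('i \<Rightarrow> 'e \<Rightarrow> real) \<Rightarrow> bool" where
  "stable_integral_representation \<alpha> P X Q m M f \<longleftrightarrow>
     sas_random_measure \<alpha> Q m M \<and>
     (\<exists>I. (\<forall>t. has_stable_integral \<alpha> Q m M (f t) (I t)) \<and> eq_fdd P X Q I)"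

section \<open>Nonsingular actions and the fields they generate\<close>

definition standard_borel :: "'s measure \<Rightarrow> bool" where
  "standard_borel S \<longleftrightarrow>
     (\<exists>T. completely_metrizable_space T \<and> second_countable T \<and> topspace T = space S \<and>
          sets S = sigma_sets (space S) {U. openin T U})"

text \<open>\<open>\<mu> \<circ> \<phi>\<^sub>t\<close>, that is \<open>A \<mapsto> \<mu> (\<phi>\<^sub>t ` A)\<close>, for an action \<open>\<phi>\<close> on the measure space \<open>S\<close> carrying \<open>\<mu>\<close>:
  the image \<open>\<phi>\<^sub>t ` A\<close> is the preimage of \<open>A\<close> under \<open>\<phi>\<close> at \<open>- t\<close>.\<close>

definition shifted_measure ::
  "'s measure \<Rightarrow> (int ^ 'd \<Rightarrow> 's \<Rightarrow> 's) \<Rightarrow> int ^ 'd \<Rightarrow> 's measure" where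
  "shifted_measure S \<phi> t = distr S S (\<phi> (- t))"

definition nonsingular_action :: "'s measure \<Rightarrow> (int ^ 'd \<Rightarrow> 's \<Rightarrow> 's) \<Rightarrow> bool" where
  "nonsingular_action S \<phi> \<longleftrightarrow>
     standard_borel S \<and> sigma_finite_measure S \<and>
     (\<forall>t. \<phi> t \<in> S \<rightarrow>\<^sub>M S) \<and>
     (\<forall>s\<in>space S. \<phi> 0 s = s) \<and>
     (\<forall>u v. \<forall>s\<in>space S. \<phi> (u + v) s = \<phi> u (\<phi> v s)) \<and>
     (\<forall>t. absolutely_continuous S (shifted_measure S \<phi> t) \<and>
          absolutely_continuous (shifted_measure S \<phi> t) S)"

definition sign_cocycle ::
  "'s measure \<Rightarrow> (int ^ 'd \<Rightarrow> 's \<Rightarrow> 's) \<Rightarrow> (int ^ 'd \<Rightarrow> 's \<Rightarrow> real) \<Rightarrow> bool" where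
  "sign_cocycle S \<phi> c \<longleftrightarrow>
     (\<forall>t. c t \<in> borel_measurable S \<and> (\<forall>s\<in>space S. c t s \<in> {-1, 1})) \<and>
     (\<forall>u v. \<forall>s\<in>space S. c (u + v) s = c u (\<phi> v s) * c v s)"

definition generated_by ::
  "real \<Rightarrow> 'w measure \<Rightarrow> (int ^ 'd \<Rightarrow> 'w \<Rightarrow> real) \<Rightarrow>
   's measure \<Rightarrow> (int ^ 'd \<Rightarrow> 's \<Rightarrow> 's) \<Rightarrow> 'v measure \<Rightarrow> ('s set \<Rightarrow> 'v \<Rightarrow> real) \<Rightarrow> bool" where
  "generated_by \<alpha> P Y S \<phi> Q N \<longleftrightarrow>
     nonsingular_action S \<phi> \<and>
     (\<exists>f c. in_Lp \<alpha> S f \<and> sign_cocycle S \<phi> c \<and>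
        (\<Union>t. {s \<in> space S. f (\<phi> t s) \<noteq> 0}) = space S \<and>
        stable_integral_representation \<alpha> P Y Q S N
          (\<lambda>t s. c t s * enn2real (RN_deriv S (shifted_measure S \<phi> t) s) powr (1 / \<alpha>) * f (\<phi> t s)))"

section \<open>Effective dimension\<close>

definition int_vec_group :: "(int ^ 'd) monoid" where
  "int_vec_group = \<lparr>carrier = UNIV, monoid.mult = (+), one = 0\<rparr>"

text \<open>In \<^const>\<open>BijGroup\<close>, bijections of \<open>space S\<close> are represented by functions that are
  \<^const>\<open>undefined\<close> elsewhere, whence the restriction. Transformations are compared pointwise.\<close>

definition action_map :: "'s measure \<Rightarrow> (int ^ 'd \<Rightarrow> 's \<Rightarrow> 's) \<Rightarrow> int ^ 'd \<Rightarrow> 's \<Rightarrow> 's" where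
  "action_map S \<phi> t = restrict (\<phi> t) (space S)"

definition transformation_group :: "'s measure \<Rightarrow> (int ^ 'd \<Rightarrow> 's \<Rightarrow> 's) \<Rightarrow> ('s \<Rightarrow> 's) monoid" where
  "transformation_group S \<phi> = (BijGroup (space S))\<lparr>carrier := range (action_map S \<phi>)\<rparr>"

text \<open>\<open>F\<close> is the image of a section \<open>\<Psi>\<close> over the free part \<open>Fb\<close> (of rank \<open>p\<close>) in a
  decomposition of the transformation group into a free and a finite summand.\<close>

definition free_part_lift ::
  "'s measure \<Rightarrow> (int ^ 'd \<Rightarrow> 's \<Rightarrow> 's) \<Rightarrow> nat \<Rightarrow> (int ^ 'd) set \<Rightarrow> bool" where
  "free_part_lift S \<phi> p F \<longleftrightarrow>
     (let A = transformation_group S \<phi> in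
      \<exists>Fb Nb \<Psi>.
        subgroup Fb A \<and> subgroup Nb A \<and>
        Fb <#>\<^bsub>A\<^esub> Nb = carrier A \<and> Fb \<inter> Nb = {\<one>\<^bsub>A\<^esub>} \<and>
        A\<lparr>carrier := Fb\<rparr> \<cong> free_Abelian_group {..<p} \<and> finite Nb \<and>
        \<Psi> \<in> hom (A\<lparr>carrier := Fb\<rparr>) int_vec_group \<and> inj_on \<Psi> Fb \<and>
        (\<forall>g\<in>Fb. action_map S \<phi> (\<Psi> g) = g) \<and>
        F = \<Psi> ` Fb)"

definition conservative_on :: "'s measure \<Rightarrow> (int ^ 'd \<Rightarrow> 's \<Rightarrow> 's) \<Rightarrow> (int ^ 'd) set \<Rightarrow> bool" where
  "conservative_on S \<phi> F \<longleftrightarrow>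
     \<not> (\<exists>W\<in>sets S. emeasure S W > 0 \<and> disjoint_family_on (\<lambda>t. \<phi> t ` W) F)"

text \<open>The field \<open>Y\<close>, generated by the action \<open>\<phi>\<close> on \<open>S\<close> through the random measure \<open>N\<close> on the
  probability space \<open>Q\<close>, has effective dimension \<open>p\<close>. The data \<open>S\<close>, \<open>\<phi>\<close>, \<open>Q\<close>, \<open>N\<close> are arguments
  because one cannot quantify existentially over their types.\<close>

definition has_effective_dimension ::
  "real \<Rightarrow> 'w measure \<Rightarrow> (int ^ 'd \<Rightarrow> 'w \<Rightarrow> real) \<Rightarrow>
   's measure \<Rightarrow> (int ^ 'd \<Rightarrow> 's \<Rightarrow> 's) \<Rightarrow> 'v measure \<Rightarrow> ('s set \<Rightarrow> 'v \<Rightarrow> real) \<Rightarrow> nat \<Rightarrow> bool" where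
  "has_effective_dimension \<alpha> P Y S \<phi> Q N p \<longleftrightarrow>
     generated_by \<alpha> P Y S \<phi> Q N \<and> 1 \<le> p \<and>
     (\<exists>F. free_part_lift S \<phi> p F \<and> \<not> conservative_on S \<phi> F)"

section \<open>Increment fields over the integer lattice\<close>

definition vec_of_int :: "int ^ 'd \<Rightarrow> real ^ 'd" where
  "vec_of_int t = (\<chi> j. of_int (t $ j))"

definition directions :: "(int ^ 'd) set" where
  "directions = {v. \<forall>j. v $ j \<in> {-1, 0, 1}} - {0}"

definition increment_field ::
  "(real ^ 'd \<Rightarrow> 'w \<Rightarrow> real) \<Rightarrow> int ^ 'd \<Rightarrow> int ^ 'd \<Rightarrow> 'w \<Rightarrow> real" where
  "increment_field X v t \<omega> = X (vec_of_int (t + v)) \<omega> - X (vec_of_int t) \<omega>"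

end

theory Submission
  imports Defs
begin

text \<open>
  Let \<open>\<eta> = H - p / \<alpha> > 0\<close> and pick \<open>\<delta>\<close> with \<open>1 / \<alpha> < \<delta> < 1 / \<gamma>\<close>. The proof shows that, almost surely, for
  all large \<open>n\<close> the increments of \<open>X\<close> between neighbouring points of the dyadic grid of mesh \<open>2\<^sup>-\<^sup>n\<close> are
  at most \<open>a n = 2\<^sup>-\<^sup>n\<^sup>\<eta> n\<^sup>\<delta>\<close>, and then chains along the grids.

  A union bound over all the \<open>2\<^sup>n\<^sup>d\<close> points of the grid would give \<open>H - d / \<alpha>\<close> in place of \<open>\<eta>\<close>. The effective
  dimension enters because the field \<open>Y\<close> of increments in a direction \<open>v\<close> takes, up to
  null sets, only about \<open>2\<^sup>n\<^sup>p\<close> different values on it. Indeed, if \<open>\<phi>\<^sub>k\<close> is the identity, then the cocycle relation gives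
  \<open>c\<^sub>2\<^sub>k = (c\<^sub>k)\<^sup>2 = 1\<close>, so the integrands representing \<open>Y t\<close> and \<open>Y (t + 2 k)\<close> are the same function
  (\<open>stable_integrand_periodic\<close>), and hence \<open>Y t = Y (t + 2 k)\<close> almost surely, as stable integrals are
  unique up to null sets (\<open>has_stable_integral_unique\<close>). The transformations \<open>\<phi>\<^sub>t\<close> form a group that is the
  sum of a free group of rank \<open>p\<close> and a finite one, so a box of side \<open>2\<^sup>n\<close> meets only \<open>O(2\<^sup>n\<^sup>p)\<close> classes
  modulo \<open>2 ker \<phi>\<close> (\<open>generated_field_classes\<close>).

  A symmetric \<open>\<alpha>\<close>-stable variable has a tail of order \<open>x\<^sup>-\<^sup>\<alpha>\<close> (\<open>stable_tail_bound\<close>). By self-similarity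
  and stationarity of the increments, some increment of level \<open>n\<close> exceeds \<open>a n\<close> with probability at most
  a constant times \<open>2\<^sup>n\<^sup>p (2\<^sup>n\<^sup>H a n)\<^sup>-\<^sup>\<alpha> = n\<^sup>-\<^sup>\<alpha>\<^sup>\<delta>\<close>. This is summable, and the Borel--Cantelli lemma
  gives the claim about the grids (\<open>dyadic_increments_bound\<close>). As \<open>\<eta> > 0\<close>, the bounds \<open>a n\<close> decay geometrically,
  so they add up along the dyadic approximations of two points to a multiple of the first one. The
  approximations converge almost surely at each of the countably many points of the separating set, and
  separability extends the estimate to all points (\<open>separable_chaining\<close>). The resulting modulus
  \<open>h\<^sup>\<eta> ln(1/h)\<^sup>\<delta>\<close> is negligible against \<open>h\<^sup>\<eta> ln(1/h)\<^sup>1\<^sup>/\<^sup>\<gamma>\<close>.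
\<close>

section \<open>Increments and tails\<close>

text \<open>Self-similarity, stationarity of the increments and the integral representations enter the proof
through the probabilities of such events.\<close>

lemma eq_fdd_increments:
  assumes "eq_fdd P X Q Y" and fin: "finite E"
  shows "measure P {\<omega> \<in> space P. \<exists>(a, b)\<in>E. x < \<bar>X a \<omega> - X b \<omega>\<bar>} =
    measure Q {\<omega> \<in> space Q. \<exists>(a, b)\<in>E. x < \<bar>Y a \<omega> - Y b \<omega>\<bar>}"
proof -
  define J where "J = fst ` E \<union> snd ` E"
  define B where "B = (\<Pi>\<^sub>M i\<in>J. (borel :: real measure))"
  define A where "A = {y \<in> space B. \<exists>(a, b)\<in>E. x < \<bar>y a - y b\<bar>}"
  have J: "finite J" and EJ: "\<And>a b. (a, b) \<in> E \<Longrightarrow> a \<in> J \<and> b \<in> J"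
    using fin by (force simp: J_def)+
  have mX: "X i \<in> borel_measurable P" "Y i \<in> borel_measurable Q" for i
    using assms(1) by (auto simp: eq_fdd_def random_field_def)
  have "{y \<in> space B. case e of (a, b) \<Rightarrow> x < \<bar>y a - y b\<bar>} \<in> sets B" if "e \<in> E" for e
  proof -
    obtain a b where e: "e = (a, b)" by force
    have [measurable]: "(\<lambda>y. y a) \<in> borel_measurable B" "(\<lambda>y. y b) \<in> borel_measurable B"
      using EJ[of a b] that e unfolding B_def by (auto intro: measurable_component_singleton)
    show ?thesis unfolding e by simp
  qed
  then have A: "A \<in> sets B"
    unfolding A_def using fin by (intro sets.sets_Collect_finite_Ex) auto
  have law: "measure M {\<omega> \<in> space M. \<exists>(a, b)\<in>E. x < \<bar>Z a \<omega> - Z b \<omega>\<bar>} =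
      measure (distr M B (\<lambda>\<omega>. \<lambda>i\<in>J. Z i \<omega>)) A"
    if "\<And>i. Z i \<in> borel_measurable M" for M :: "'m measure" and Z
  proof -
    have "(\<lambda>\<omega>. \<lambda>i\<in>J. Z i \<omega>) \<in> M \<rightarrow>\<^sub>M B"
      unfolding B_def using that by (intro measurable_restrict)
    moreover have "(\<lambda>\<omega>. \<lambda>i\<in>J. Z i \<omega>) -` A \<inter> space M =
        {\<omega> \<in> space M. \<exists>(a, b)\<in>E. x < \<bar>Z a \<omega> - Z b \<omega>\<bar>}"
      using EJ by (fastforce simp: A_def B_def space_PiM)
    ultimately show ?thesis
      using A by (simp add: measure_distr)
  qed
  show ?thesis
    unfolding law[OF mX(1)] law[OF mX(2)] B_def
    using assms(1) J by (simp add: eq_fdd_def)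
qed

lemma eq_fdd_increment:
  assumes "eq_fdd P X Q Y"
  shows "measure P {\<omega> \<in> space P. x < \<bar>X a \<omega> - X b \<omega>\<bar>} =
    measure Q {\<omega> \<in> space Q. x < \<bar>Y a \<omega> - Y b \<omega>\<bar>}"
  using eq_fdd_increments[OF assms, of "{(a, b)}" x] by simp

text \<open>The averaging argument behind Levy's continuity theorem: the mean of \<open>1 - cos (\<theta> y)\<close> over
\<open>\<theta> \<in> [0, 2 / x]\<close> is at least \<open>1 / 2\<close> once \<open>x < \<bar>y\<bar>\<close>, while its expectation is \<open>1 - Re (char N \<theta>)\<close>,
which is at most \<open>c \<theta>\<^sup>\<alpha>\<close>.\<close>

lemma stable_tail_bound:
  assumes "real_distribution N" and "0 < \<alpha>" "0 \<le> c" "0 < x"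
    and char: "\<And>\<theta>. char N \<theta> = complex_of_real (exp (- (c * \<bar>\<theta>\<bar> powr \<alpha>)))"
  shows "measure N {y. x < \<bar>y\<bar>} \<le> 2 * c * (2 / x) powr \<alpha>"
proof -
  interpret N: real_distribution N by fact
  interpret NL: pair_sigma_finite N lborel ..
  define u where "u = 2 / x"
  have u: "0 < u" using assms by (simp add: u_def)
  have inner: "(\<integral>\<^sup>+ y. ennreal (1 - cos (\<theta> * y)) * indicator {0..u} \<theta> \<partial>N) \<le>
      ennreal (c * u powr \<alpha>) * indicator {0..u} \<theta>" for \<theta>
  proof (cases "\<theta> \<in> {0..u}")
    case True
    have i: "integrable N (\<lambda>y. iexp (\<theta> * y))"
      by (intro N.integrable_const_bound[where B=1]) auto
    have "Re (char N \<theta>) = (\<integral>y. cos (\<theta> * y) \<partial>N)"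
      unfolding char_def by (subst integral_Re[symmetric, OF i]) (simp add: Re_exp)
    then have "(\<integral>y. 1 - cos (\<theta> * y) \<partial>N) = 1 - exp (- (c * \<bar>\<theta>\<bar> powr \<alpha>))"
      using N.prob_space by (subst Bochner_Integration.integral_diff)
        (auto simp: char intro!: N.integrable_const_bound[where B=1])
    also have "\<dots> \<le> c * \<bar>\<theta>\<bar> powr \<alpha>"
      using exp_ge_add_one_self[of "- (c * \<bar>\<theta>\<bar> powr \<alpha>)"] by simp
    also have "\<dots> \<le> c * u powr \<alpha>"
      using True assms by (intro mult_left_mono powr_mono2) auto
    finally have le: "(\<integral>y. 1 - cos (\<theta> * y) \<partial>N) \<le> c * u powr \<alpha>" .
    have "(\<integral>\<^sup>+ y. ennreal (1 - cos (\<theta> * y)) \<partial>N) = ennreal (\<integral>y. 1 - cos (\<theta> * y) \<partial>N)"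
      by (intro nn_integral_eq_integral N.integrable_const_bound[where B=2])
        (auto simp: abs_le_iff intro!: AE_I2) 
    then show ?thesis
      using True le by (simp add: ennreal_leI)
  qed simp
  have outer: "ennreal (u / 2) * indicator {y. x < \<bar>y\<bar>} y \<le>
      (\<integral>\<^sup>+ \<theta>. ennreal (1 - cos (\<theta> * y)) * indicator {0..u} \<theta> \<partial>lborel)" for y
  proof (cases "x < \<bar>y\<bar>")
    case True
    then have y: "y \<noteq> 0" using assms by auto
    have "(\<integral>\<^sup>+ \<theta>. ennreal (1 - cos (\<theta> * y)) * indicator {0..u} \<theta> \<partial>lborel) =
        ennreal ((u - sin (u * y) / y) - (0 - sin (0 * y) / y))"
      using y u by (intro nn_integral_FTC_Icc[where F="\<lambda>\<theta>. \<theta> - sin (\<theta> * y) / y"])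
        (auto intro!: derivative_eq_intros)
    moreover have "sin (u * y) / y \<le> u / 2"
    proof -
      have "\<bar>sin (u * y) / y\<bar> \<le> 1 / \<bar>y\<bar>"
        unfolding abs_divide by (intro divide_right_mono) auto
      also have "\<dots> \<le> 1 / x"
        using True assms by (intro divide_left_mono) auto
      finally have "\<bar>sin (u * y) / y\<bar> \<le> 1 / x" .
      from order_trans[OF abs_ge_self this] show ?thesis by (simp add: u_def)
    qed
    ultimately show ?thesis using True by (auto intro!: ennreal_leI)
  qed simp
  have set: "{y. x < \<bar>y\<bar>} \<in> sets N" by simp
  have "ennreal (u / 2) * emeasure N {y. x < \<bar>y\<bar>} =
      (\<integral>\<^sup>+ y. ennreal (u / 2) * indicator {y. x < \<bar>y\<bar>} y \<partial>N)"
    using set by (simp add: nn_integral_cmult_indicator)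
  also have "\<dots> \<le> (\<integral>\<^sup>+ y. \<integral>\<^sup>+ \<theta>. ennreal (1 - cos (\<theta> * y)) * indicator {0..u} \<theta> \<partial>lborel \<partial>N)"
    by (intro nn_integral_mono outer)
  also have "\<dots> = (\<integral>\<^sup>+ \<theta>. \<integral>\<^sup>+ y. ennreal (1 - cos (\<theta> * y)) * indicator {0..u} \<theta> \<partial>N \<partial>lborel)"
    by (intro NL.Fubini'[symmetric]) simp
  also have "\<dots> \<le> (\<integral>\<^sup>+ \<theta>. ennreal (c * u powr \<alpha>) * indicator {0..u} \<theta> \<partial>lborel)"
    by (intro nn_integral_mono inner)
  also have "\<dots> = ennreal (c * u powr \<alpha>) * ennreal u"
    using u by (simp add: nn_integral_cmult_indicator)
  finally have "ennreal (u / 2 * measure N {y. x < \<bar>y\<bar>}) \<le> ennreal (c * u powr \<alpha> * u)"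
    using u assms by (simp only: ennreal_mult[symmetric] N.emeasure_eq_measure mult_nonneg_nonneg
        measure_nonneg powr_ge_zero less_imp_le half_gt_zero)
  then have "u / 2 * measure N {y. x < \<bar>y\<bar>} \<le> c * u powr \<alpha> * u"
    using u assms by (subst (asm) ennreal_le_iff) auto
  then have "u * measure N {y. x < \<bar>y\<bar>} \<le> u * (2 * c * u powr \<alpha>)"
    by (simp add: algebra_simps)
  then show ?thesis
    using u unfolding u_def[symmetric] by simp
qed

section \<open>Uniqueness of stable integrals\<close>

lemma
  assumes "sas_random_measure \<alpha> Q m M"
  shows sas_random_measure_prob_space: "prob_space Q"
    and sas_random_measure_measurable: "\<And>A. A \<in> fmeasurable m \<Longrightarrow> M A \<in> borel_measurable Q"
    and sas_random_measure_char: "\<And>A \<theta>. A \<in> fmeasurable m \<Longrightarrow> char (distr Q borel (M A)) \<theta> =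
           complex_of_real (exp (- (\<bar>\<theta>\<bar> powr \<alpha> * measure m A)))"
    and sas_random_measure_indep: "\<And>(A :: nat \<Rightarrow> _) n. A ` {..<n} \<subseteq> fmeasurable m \<Longrightarrow>
           disjoint_family_on A {..<n} \<Longrightarrow> prob_space.indep_vars Q (\<lambda>_. borel) (\<lambda>i. M (A i)) {..<n}"
    and sas_random_measure_sums: "\<And>A :: nat \<Rightarrow> _. range A \<subseteq> fmeasurable m \<Longrightarrow> disjoint_family A \<Longrightarrow>
           (\<Union>i. A i) \<in> fmeasurable m \<Longrightarrow> AE \<omega> in Q. (\<lambda>i. M (A i) \<omega>) sums M (\<Union>i. A i) \<omega>"
  using assms unfolding sas_random_measure_def by blast+

lemma sas_random_measure_finite_union:
  fixes A :: "nat \<Rightarrow> 'e set"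
  assumes M: "sas_random_measure \<alpha> Q m M"
    and A: "\<And>i. i < n \<Longrightarrow> A i \<in> fmeasurable m" and disj: "disjoint_family_on A {..<n}"
  shows "AE \<omega> in Q. M (\<Union>i<n. A i) \<omega> = (\<Sum>i<n. M (A i) \<omega>)"
proof -
  \<comment> \<open>The values of \<open>M\<close> on a constant sequence of empty sets form a convergent series.\<close>
  have empty: "AE \<omega> in Q. M {} \<omega> = 0"
    using sas_random_measure_sums[OF M, of "\<lambda>_. {}"]
    by (auto simp: disjoint_family_on_def summable_const_iff dest!: sums_summable elim!: eventually_mono)
  define B where "B i = (if i < n then A i else {})" for i
  have U: "(\<Union>i. B i) = (\<Union>i<n. A i)"
    by (auto simp: B_def split: if_splits)
  have "AE \<omega> in Q. (\<lambda>i. M (B i) \<omega>) sums M (\<Union>i. B i) \<omega>"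
  proof (rule sas_random_measure_sums[OF M])
    show "range B \<subseteq> fmeasurable m" using A by (auto simp: B_def)
    show "disjoint_family B" using disj by (auto simp: disjoint_family_on_def B_def)
    show "(\<Union>i. B i) \<in> fmeasurable m" unfolding U using A by (intro fmeasurable.finite_UN) auto
  qed
  with empty show ?thesis
  proof eventually_elim
    case (elim \<omega>)
    have "(\<lambda>i. M (B i) \<omega>) sums (\<Sum>i<n. M (B i) \<omega>)"
      using elim(1) by (intro sums_finite) (auto simp: B_def)
    then have "M (\<Union>i. B i) \<omega> = (\<Sum>i<n. M (B i) \<omega>)"
      using elim(2) sums_unique2 by blast
    then show ?case unfolding U by (simp add: B_def)
  qed
qed

text \<open>Integrals of two simple functions can only be subtracted after both are written over one partition.
The cells are taken nonempty so that each \<open>y i\<close> is a value of \<open>s\<close>.\<close>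

lemma simple_stable_integral_partition:
  fixes A :: "nat \<Rightarrow> 'e set"
  assumes M: "sas_random_measure \<alpha> Q m M"
    and A: "\<And>i. i < n \<Longrightarrow> A i \<in> fmeasurable m" and disj: "disjoint_family_on A {..<n}"
    and sub: "\<And>i. i < n \<Longrightarrow> A i \<noteq> {} \<and> A i \<subseteq> space m"
    and val: "\<And>i x. i < n \<Longrightarrow> x \<in> A i \<Longrightarrow> s x = y i"
    and supp: "\<And>x. x \<in> space m \<Longrightarrow> s x \<noteq> 0 \<Longrightarrow> \<exists>i<n. x \<in> A i"
    and fin: "finite (s ` space m)"
  shows "AE \<omega> in Q. simple_stable_integral m M s \<omega> = (\<Sum>i<n. y i * M (A i) \<omega>)"
proof -
  have level: "AE \<omega> in Q. M (s -` {z} \<inter> space m) \<omega> = (\<Sum>i | i < n \<and> y i = z. M (A i) \<omega>)"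
    if z: "z \<in> s ` space m - {0}" for z
  proof -
    define J where "J = {i. i < n \<and> y i = z}"
    have "finite J" by (simp add: J_def)
    then obtain e where e: "bij_betw e {..<card J} J"
      using ex_bij_betw_nat_finite[of J] by (auto simp: atLeast0LessThan)
    have eJ: "e k < n" "y (e k) = z" if "k < card J" for k
      using bij_betwE[OF e] that by (auto simp: J_def)
    have un: "(\<Union>k<card J. A (e k)) = s -` {z} \<inter> space m" (is "?l = ?r")
    proof
      show "?l \<subseteq> ?r" using eJ val sub by fastforce
      show "?r \<subseteq> ?l"
      proof
        fix x assume x: "x \<in> ?r"
        then obtain i where i: "i < n" "x \<in> A i" using supp[of x] z x by auto
        then have "i \<in> J" using x val by (auto simp: J_def)
        then obtain k where "k < card J" "e k = i"
          using e by (metis bij_betw_iff_bijections lessThan_iff)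
        then show "x \<in> ?l" using i by auto
      qed
    qed
    have "AE \<omega> in Q. M (\<Union>k<card J. A (e k)) \<omega> = (\<Sum>k<card J. M (A (e k)) \<omega>)"
    proof (rule sas_random_measure_finite_union[OF M])
      show "disjoint_family_on (\<lambda>k. A (e k)) {..<card J}"
        unfolding disjoint_family_on_def
      proof (intro ballI impI)
        fix k l assume kl: "k \<in> {..<card J}" "l \<in> {..<card J}" "k \<noteq> l"
        then have "e k \<noteq> e l" using bij_betw_imp_inj_on[OF e] by (auto dest: inj_onD)
        then show "A (e k) \<inter> A (e l) = {}"
          using disjoint_family_onD[OF disj, of "e k" "e l"] eJ kl by auto
      qed
    qed (use A eJ in auto)
    then show ?thesis
      unfolding un sum.reindex_bij_betw[OF e, of "\<lambda>i. M (A i) _"] J_def[symmetric] .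
  qed
  have fin0: "finite (s ` space m - {0})" using fin by simp
  have "AE \<omega> in Q. \<forall>z\<in>s ` space m - {0}.
      M (s -` {z} \<inter> space m) \<omega> = (\<Sum>i | i < n \<and> y i = z. M (A i) \<omega>)"
    using level fin0 by (intro AE_finite_allI) auto
  then show ?thesis
  proof eventually_elim
    case (elim \<omega>)
    have yi: "y i \<in> s ` space m" if "i < n" for i
      using sub[OF that] val[OF that] by (auto simp: image_iff) (metis subsetD)
    have "simple_stable_integral m M s \<omega> =
        (\<Sum>z\<in>s ` space m - {0}. \<Sum>i | i < n \<and> y i = z. y i * M (A i) \<omega>)"
      unfolding simple_stable_integral_def using elim
      by (intro sum.cong refl) (simp add: sum_distrib_left)
    also have "\<dots> = (\<Sum>z\<in>s ` space m - {0}. \<Sum>i | i \<in> {i. i < n \<and> y i \<noteq> 0} \<and> y i = z. y i * M (A i) \<omega>)"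
      by (intro sum.cong refl) auto
    also have "\<dots> = (\<Sum>i | i < n \<and> y i \<noteq> 0. y i * M (A i) \<omega>)"
      using fin yi by (intro sum.group) auto
    also have "\<dots> = (\<Sum>i<n. y i * M (A i) \<omega>)"
      by (intro sum.mono_neutral_left) auto
    finally show ?case .
  qed
qed

lemma char_weighted_sum:
  fixes A :: "nat \<Rightarrow> 'e set"
  assumes M: "sas_random_measure \<alpha> Q m M"
    and A: "\<And>i. i < n \<Longrightarrow> A i \<in> fmeasurable m" and disj: "disjoint_family_on A {..<n}"
  shows "char (distr Q borel (\<lambda>\<omega>. \<Sum>i<n. y i * M (A i) \<omega>)) \<theta> =
    complex_of_real (exp (- ((\<Sum>i<n. \<bar>y i\<bar> powr \<alpha> * measure m (A i)) * \<bar>\<theta>\<bar> powr \<alpha>)))"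
proof -
  interpret Q: prob_space Q using sas_random_measure_prob_space[OF M] .
  have meas: "M (A i) \<in> borel_measurable Q" if "i < n" for i
    using sas_random_measure_measurable[OF M] A that by blast
  have "Q.indep_vars (\<lambda>_. borel) (\<lambda>i. M (A i)) {..<n}"
    using sas_random_measure_indep[OF M _ disj] A by auto
  then have "Q.indep_vars (\<lambda>_. borel) (\<lambda>i \<omega>. y i * M (A i) \<omega>) {..<n}"
    by (rule Q.indep_vars_compose2[where Y="\<lambda>i x. y i * x"]) simp
  then have "char (distr Q borel (\<lambda>\<omega>. \<Sum>i<n. y i * M (A i) \<omega>)) \<theta> =
      (\<Prod>i<n. char (distr Q borel (\<lambda>\<omega>. y i * M (A i) \<omega>)) \<theta>)"
    by (rule Q.char_distr_sum)
  also have "\<dots> = (\<Prod>i<n. complex_of_real (exp (- (\<bar>y i\<bar> powr \<alpha> * measure m (A i) * \<bar>\<theta>\<bar> powr \<alpha>))))"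
  proof (intro prod.cong refl)
    fix i assume i: "i \<in> {..<n}"
    have "char (distr Q borel (\<lambda>\<omega>. y i * M (A i) \<omega>)) \<theta> = char (distr Q borel (M (A i))) (\<theta> * y i)"
      using meas[of i] i by (simp add: char_def integral_distr algebra_simps)
    also have "\<dots> = complex_of_real (exp (- (\<bar>\<theta> * y i\<bar> powr \<alpha> * measure m (A i))))"
      using sas_random_measure_char[OF M] A i by blast
    finally show "char (distr Q borel (\<lambda>\<omega>. y i * M (A i) \<omega>)) \<theta> =
        complex_of_real (exp (- (\<bar>y i\<bar> powr \<alpha> * measure m (A i) * \<bar>\<theta>\<bar> powr \<alpha>)))"
      by (simp add: abs_mult powr_mult algebra_simps)
  qed
  also have "\<dots> = complex_of_real (exp (\<Sum>i<n. - (\<bar>y i\<bar> powr \<alpha> * measure m (A i) * \<bar>\<theta>\<bar> powr \<alpha>)))"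
    by (simp add: exp_sum)
  finally show ?thesis
    by (simp add: sum_negf sum_distrib_right)
qed

text \<open>A nonzero simple function is bounded away from \<open>0\<close> on its support, so Markov's inequality applies.\<close>

lemma fmeasurable_simple_support:
  assumes s: "simple_function m s" "in_Lp \<alpha> m s" and "0 < \<alpha>"
  shows "{x \<in> space m. s x \<noteq> (0::real)} \<in> fmeasurable m"
proof (cases "s ` space m \<subseteq> {0}")
  case True
  then have "{x \<in> space m. s x \<noteq> 0} = {}" by auto
  then show ?thesis by (simp only: fmeasurable.empty_sets)
next
  case False
  have meas[measurable]: "s \<in> borel_measurable m" using s by (simp add: in_Lp_def)
  define V where "V = (\<lambda>y. \<bar>y\<bar> powr \<alpha>) ` (s ` space m - {0})"
  have V: "finite V" "V \<noteq> {}" using s(1) False by (auto simp: V_def simple_function_def)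
  define c where "c = Min V"
  have "c \<in> V" using V by (simp add: c_def)
  then have c: "0 < c" by (auto simp: V_def)
  have "integrable m (\<lambda>x. \<bar>s x\<bar> powr \<alpha>)" using s by (simp add: in_Lp_def)
  then have "integrable m (indicator {x \<in> space m. s x \<noteq> 0} :: _ \<Rightarrow> real)"
  proof (rule Bochner_Integration.integrable_bound[OF Bochner_Integration.integrable_mult_right[where c="1/c"]])
    have "c \<le> \<bar>s x\<bar> powr \<alpha>" if "x \<in> space m" "s x \<noteq> 0" for x
      unfolding c_def using V that by (intro Min_le) (auto simp: V_def)
    then show "AE x in m. norm (indicator {x \<in> space m. s x \<noteq> 0} x :: real) \<le> norm (1 / c * \<bar>s x\<bar> powr \<alpha>)"
      using c by (intro AE_I2) (auto simp: indicator_def field_simps)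
  qed auto
  then show ?thesis
    by (simp add: integrable_indicator_iff fmeasurable_def Int_absorb2 subset_eq)
qed

text \<open>The joint level sets of \<open>s\<close> and \<open>t\<close>, except the one where both vanish, have finite measure and are
disjoint. Over them the difference of the integrals is a sum of independent stable variables, whose
scales add up to the integral of \<open>\<bar>s - t\<bar>\<^sup>\<alpha>\<close>.\<close>

lemma char_simple_stable_integral_diff:
  assumes M: "sas_random_measure \<alpha> Q m M" and "0 < \<alpha>"
    and s: "simple_function m s" "in_Lp \<alpha> m s"
    and t: "simple_function m t" "in_Lp \<alpha> m t"
  shows "(\<lambda>\<omega>. simple_stable_integral m M s \<omega> - simple_stable_integral m M t \<omega>) \<in> borel_measurable Q"
    and "char (distr Q borel (\<lambda>\<omega>. simple_stable_integral m M s \<omega> - simple_stable_integral m M t \<omega>)) \<theta> =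
      complex_of_real (exp (- ((\<integral>x. \<bar>s x - t x\<bar> powr \<alpha> \<partial>m) * \<bar>\<theta>\<bar> powr \<alpha>)))"
proof -
  interpret Q: prob_space Q using sas_random_measure_prob_space[OF M] .
  define r where "r x = (s x, t x)" for x
  define Z where "Z = r ` space m - {(0, 0)}"
  have fin: "finite (s ` space m)" "finite (t ` space m)"
    using s t by (auto simp: simple_function_def)
  have Z: "finite Z"
    by (rule finite_subset[of _ "s ` space m \<times> t ` space m"]) (use fin in \<open>auto simp: Z_def r_def\<close>)
  obtain e where e: "bij_betw e {..<card Z} Z"
    using ex_bij_betw_nat_finite[OF Z] by (auto simp: atLeast0LessThan)
  define n where "n = card Z"
  define A where "A i = {x \<in> space m. r x = e i}" for i
  define D where "D = {x \<in> space m. s x \<noteq> 0} \<union> {x \<in> space m. t x \<noteq> 0}"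
  have D: "D \<in> fmeasurable m"
    unfolding D_def using assms by (intro fmeasurable.Un fmeasurable_simple_support)
  have sm: "s \<in> borel_measurable m" "t \<in> borel_measurable m"
    using s t by (auto simp: in_Lp_def)
  have eZ: "e i \<in> Z" if "i < n" for i
    using bij_betwE[OF e] that by (auto simp: n_def)
  have A: "A i \<in> fmeasurable m" if "i < n" for i
  proof (rule fmeasurableI2[OF D])
    show "A i \<subseteq> D" using eZ[OF that] by (auto simp: A_def D_def Z_def r_def)
    have "A i = {x \<in> space m. s x = fst (e i) \<and> t x = snd (e i)}"
      by (auto simp: A_def r_def prod_eq_iff)
    then show "A i \<in> sets m" using sm by simp
  qed
  have disj: "disjoint_family_on A {..<n}"
    using bij_betw_imp_inj_on[OF e] by (auto simp: disjoint_family_on_def A_def n_def inj_on_def)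
  have sub: "A i \<noteq> {} \<and> A i \<subseteq> space m" if "i < n" for i
    using eZ[OF that] by (auto simp: A_def Z_def)
  have cover: "\<exists>i<n. x \<in> A i" if "x \<in> space m" "r x \<noteq> (0, 0)" for x
  proof -
    have "r x \<in> Z" using that by (auto simp: Z_def)
    then obtain i where "i < n" "e i = r x"
      using e unfolding n_def by (metis bij_betw_iff_bijections lessThan_iff)
    then show ?thesis using that by (auto simp: A_def)
  qed
  define W where "W \<omega> = (\<Sum>i<n. (fst (e i) - snd (e i)) * M (A i) \<omega>)" for \<omega>
  have level: "M (u -` {z} \<inter> space m) \<in> borel_measurable Q"
    if u: "simple_function m u" "in_Lp \<alpha> m u" and "z \<noteq> 0" for u :: "_ \<Rightarrow> real" and z
  proof (rule sas_random_measure_measurable[OF M fmeasurableI2[OF fmeasurable_simple_support[OF u \<open>0 < \<alpha>\<close>]]])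
    show "u -` {z} \<inter> space m \<in> sets m"
      using u(2) by (intro measurable_sets[of u m borel]) (auto simp: in_Lp_def)
  qed (use that in auto)
  show meas: "(\<lambda>\<omega>. simple_stable_integral m M s \<omega> - simple_stable_integral m M t \<omega>) \<in> borel_measurable Q"
    unfolding simple_stable_integral_def using level s t
    by (intro borel_measurable_diff borel_measurable_sum borel_measurable_times) auto
  have W: "W \<in> borel_measurable Q"
    unfolding W_def using A by (auto intro!: borel_measurable_sum borel_measurable_times sas_random_measure_measurable[OF M])
  have "AE \<omega> in Q. simple_stable_integral m M s \<omega> = (\<Sum>i<n. fst (e i) * M (A i) \<omega>)"
  proof (rule simple_stable_integral_partition[OF M A disj sub])
    show "\<exists>i<n. x \<in> A i" if "x \<in> space m" "s x \<noteq> 0" for x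
      using that by (intro cover) (auto simp: r_def)
    show "s x = fst (e i)" if "i < n" "x \<in> A i" for i x
      using that unfolding A_def r_def by (metis (mono_tags, lifting) fst_conv mem_Collect_eq)
  qed (use fin in auto)
  moreover have "AE \<omega> in Q. simple_stable_integral m M t \<omega> = (\<Sum>i<n. snd (e i) * M (A i) \<omega>)"
  proof (rule simple_stable_integral_partition[OF M A disj sub])
    show "\<exists>i<n. x \<in> A i" if "x \<in> space m" "t x \<noteq> 0" for x
      using that by (intro cover) (auto simp: r_def)
    show "t x = snd (e i)" if "i < n" "x \<in> A i" for i x
      using that unfolding A_def r_def by (metis (mono_tags, lifting) snd_conv mem_Collect_eq)
  qed (use fin in auto)
  ultimately have "AE \<omega> in Q. simple_stable_integral m M s \<omega> - simple_stable_integral m M t \<omega> = W \<omega>"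
    by eventually_elim (simp add: W_def left_diff_distrib sum_subtractf)
  then have "distr Q borel (\<lambda>\<omega>. simple_stable_integral m M s \<omega> - simple_stable_integral m M t \<omega>) = distr Q borel W"
    using meas W by (intro distr_cong_AE) auto
  moreover have "(\<integral>x. \<bar>s x - t x\<bar> powr \<alpha> \<partial>m) = (\<Sum>i<n. \<bar>fst (e i) - snd (e i)\<bar> powr \<alpha> * measure m (A i))"
  proof -
    have "\<bar>s x - t x\<bar> powr \<alpha> = (\<Sum>i<n. \<bar>fst (e i) - snd (e i)\<bar> powr \<alpha> * indicator (A i) x)"
      if x: "x \<in> space m" for x
    proof (cases "r x = (0, 0)")
      case True
      then have "x \<notin> A i" if "i < n" for i
        using eZ[OF that] by (auto simp: A_def Z_def)
      then show ?thesis using True by (simp add: r_def)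
    next
      case False
      then obtain i where i: "i < n" "x \<in> A i" using cover x by blast
      then have "(\<Sum>j<n. \<bar>fst (e j) - snd (e j)\<bar> powr \<alpha> * indicator (A j) x) =
          (\<Sum>j\<in>{i}. \<bar>fst (e j) - snd (e j)\<bar> powr \<alpha> * indicator (A j) x)"
        using disj by (intro sum.mono_neutral_right) (auto simp: disjoint_family_on_def indicator_def)
      moreover have "s x = fst (e i)" "t x = snd (e i)"
        using i unfolding A_def r_def by (metis (mono_tags, lifting) fst_conv snd_conv mem_Collect_eq)+
      ultimately show ?thesis using i by simp
    qed
    then have "(\<integral>x. \<bar>s x - t x\<bar> powr \<alpha> \<partial>m) =
        (\<integral>x. (\<Sum>i<n. \<bar>fst (e i) - snd (e i)\<bar> powr \<alpha> * indicator (A i) x) \<partial>m)"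
      by (intro Bochner_Integration.integral_cong) auto
    also have "\<dots> = (\<Sum>i<n. \<integral>x. \<bar>fst (e i) - snd (e i)\<bar> powr \<alpha> * indicator (A i) x \<partial>m)"
      using A by (intro Bochner_Integration.integral_sum integrable_mult_right integrable_real_indicator)
        (auto simp: fmeasurable_def)
    also have "\<dots> = (\<Sum>i<n. \<bar>fst (e i) - snd (e i)\<bar> powr \<alpha> * measure m (A i))"
      using sub by (intro sum.cong refl) (simp add: Int_absorb2)
    finally show ?thesis .
  qed
  ultimately show "char (distr Q borel (\<lambda>\<omega>. simple_stable_integral m M s \<omega> - simple_stable_integral m M t \<omega>)) \<theta> =
      complex_of_real (exp (- ((\<integral>x. \<bar>s x - t x\<bar> powr \<alpha> \<partial>m) * \<bar>\<theta>\<bar> powr \<alpha>)))"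
    using char_weighted_sum[OF M A disj, of "\<lambda>i. fst (e i) - snd (e i)" \<theta>] by (simp add: W_def[abs_def])
qed

lemma powr_abs_diff_le:
  fixes a b :: real
  assumes "0 < \<alpha>"
  shows "\<bar>a - b\<bar> powr \<alpha> \<le> 2 powr \<alpha> * (\<bar>a\<bar> powr \<alpha> + \<bar>b\<bar> powr \<alpha>)"
proof -
  have "\<bar>a - b\<bar> powr \<alpha> \<le> (2 * max \<bar>a\<bar> \<bar>b\<bar>) powr \<alpha>"
    using assms by (intro powr_mono2) auto
  also have "\<dots> = 2 powr \<alpha> * (max \<bar>a\<bar> \<bar>b\<bar>) powr \<alpha>"
    by (simp add: powr_mult)
  also have "(max \<bar>a\<bar> \<bar>b\<bar>) powr \<alpha> \<le> \<bar>a\<bar> powr \<alpha> + \<bar>b\<bar> powr \<alpha>"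
    by (simp add: max_def)
  finally show ?thesis by simp
qed

lemma in_Lp_diff:
  assumes "0 < \<alpha>" "in_Lp \<alpha> m f" "in_Lp \<alpha> m g"
  shows "in_Lp \<alpha> m (\<lambda>x. f x - g x)"
proof -
  have [measurable]: "f \<in> borel_measurable m" "g \<in> borel_measurable m"
    and int: "integrable m (\<lambda>x. 2 powr \<alpha> * (\<bar>f x\<bar> powr \<alpha> + \<bar>g x\<bar> powr \<alpha>))"
    using assms by (auto simp: in_Lp_def)
  have "norm (\<bar>f x - g x\<bar> powr \<alpha>) \<le> norm (2 powr \<alpha> * (\<bar>f x\<bar> powr \<alpha> + \<bar>g x\<bar> powr \<alpha>))" for x
    using powr_abs_diff_le[OF \<open>0 < \<alpha>\<close>, of "f x" "g x"] by simp
  then have "integrable m (\<lambda>x. \<bar>f x - g x\<bar> powr \<alpha>)"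
    by (intro Bochner_Integration.integrable_bound[OF int]) auto
  then show ?thesis
    unfolding in_Lp_def by simp
qed

text \<open>If two sequences of simple functions have the same limit in \<open>L\<^sup>\<alpha>\<close>, then their differences tend to \<open>0\<close>
in \<open>L\<^sup>\<alpha>\<close>, and by the tail bound the differences of their integrals tend to \<open>0\<close> in probability.\<close>

lemma has_stable_integral_unique:
  assumes M: "sas_random_measure \<alpha> Q m M" and \<alpha>: "0 < \<alpha>"
    and I: "has_stable_integral \<alpha> Q m M f I" and J: "has_stable_integral \<alpha> Q m M g J"
    and eq: "\<And>x. x \<in> space m \<Longrightarrow> f x = g x"
  shows "AE \<omega> in Q. I \<omega> = J \<omega>"
proof -
  interpret Q: prob_space Q using sas_random_measure_prob_space[OF M] .
  let ?S = "simple_stable_integral m M"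
  have [measurable]: "I \<in> borel_measurable Q" "J \<in> borel_measurable Q"
    and f: "in_Lp \<alpha> m f" and g: "in_Lp \<alpha> m g"
    using I J by (auto simp: has_stable_integral_def)
  obtain s where s: "\<And>n. simple_function m (s n)" "\<And>n. in_Lp \<alpha> m (s n)"
    and s0: "(\<lambda>n. \<integral>x. \<bar>s n x - f x\<bar> powr \<alpha> \<partial>m) \<longlonglongrightarrow> 0"
    and sI: "\<And>\<epsilon>. \<epsilon> > 0 \<Longrightarrow> (\<lambda>n. measure Q {\<omega> \<in> space Q. \<bar>?S (s n) \<omega> - I \<omega>\<bar> > \<epsilon>}) \<longlonglongrightarrow> 0"
    using I unfolding has_stable_integral_def by blast
  obtain t where t: "\<And>n. simple_function m (t n)" "\<And>n. in_Lp \<alpha> m (t n)"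
    and t0: "(\<lambda>n. \<integral>x. \<bar>t n x - g x\<bar> powr \<alpha> \<partial>m) \<longlonglongrightarrow> 0"
    and tJ: "\<And>\<epsilon>. \<epsilon> > 0 \<Longrightarrow> (\<lambda>n. measure Q {\<omega> \<in> space Q. \<bar>?S (t n) \<omega> - J \<omega>\<bar> > \<epsilon>}) \<longlonglongrightarrow> 0"
    using J unfolding has_stable_integral_def by blast
  define c where "c n = (\<integral>x. \<bar>s n x - t n x\<bar> powr \<alpha> \<partial>m)" for n
  have c_le: "c n \<le> 2 powr \<alpha> * ((\<integral>x. \<bar>s n x - f x\<bar> powr \<alpha> \<partial>m) + (\<integral>x. \<bar>t n x - g x\<bar> powr \<alpha> \<partial>m))" for n
  proof -
    have i: "integrable m (\<lambda>x. \<bar>s n x - f x\<bar> powr \<alpha>)" "integrable m (\<lambda>x. \<bar>t n x - g x\<bar> powr \<alpha>)"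
      "integrable m (\<lambda>x. \<bar>s n x - t n x\<bar> powr \<alpha>)"
      using in_Lp_diff[OF \<alpha> s(2)[of n] f] in_Lp_diff[OF \<alpha> t(2)[of n] g] in_Lp_diff[OF \<alpha> s(2)[of n] t(2)[of n]]
      by (simp_all add: in_Lp_def)
    have "c n \<le> (\<integral>x. 2 powr \<alpha> * (\<bar>s n x - f x\<bar> powr \<alpha> + \<bar>t n x - g x\<bar> powr \<alpha>) \<partial>m)"
      unfolding c_def
    proof (rule integral_mono[OF i(3)])
      fix x assume "x \<in> space m"
      then show "\<bar>s n x - t n x\<bar> powr \<alpha> \<le> 2 powr \<alpha> * (\<bar>s n x - f x\<bar> powr \<alpha> + \<bar>t n x - g x\<bar> powr \<alpha>)"
        using powr_abs_diff_le[OF \<alpha>, of "s n x - f x" "t n x - g x"] eq by simp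
    qed (use i in auto)
    then show ?thesis using i by simp
  qed
  have lim: "(\<lambda>n. 2 powr \<alpha> * ((\<integral>x. \<bar>s n x - f x\<bar> powr \<alpha> \<partial>m) + (\<integral>x. \<bar>t n x - g x\<bar> powr \<alpha> \<partial>m))) \<longlonglongrightarrow> 0"
    using tendsto_mult[OF tendsto_const tendsto_add[OF s0 t0], of "2 powr \<alpha>"] by simp
  have c0: "c \<longlonglongrightarrow> 0"
  proof (rule tendsto_sandwich[OF _ _ tendsto_const lim])
    show "\<forall>\<^sub>F n in sequentially. 0 \<le> c n"
      by (simp add: c_def)
    show "\<forall>\<^sub>F n in sequentially. c n \<le> 2 powr \<alpha> * ((\<integral>x. \<bar>s n x - f x\<bar> powr \<alpha> \<partial>m) + (\<integral>x. \<bar>t n x - g x\<bar> powr \<alpha> \<partial>m))"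
      using c_le by (intro always_eventually allI)
  qed
  define U where "U n \<omega> = ?S (s n) \<omega> - ?S (t n) \<omega>" for n \<omega>
  have U[measurable]: "U n \<in> borel_measurable Q" for n
    unfolding U_def[abs_def] by (intro char_simple_stable_integral_diff(1)[OF M \<alpha> s t])
  have tail: "measure Q {\<omega> \<in> space Q. x < \<bar>U n \<omega>\<bar>} \<le> 2 * c n * (2 / x) powr \<alpha>" if "0 < x" for x n
  proof -
    have "measure (distr Q borel (U n)) {y. x < \<bar>y\<bar>} \<le> 2 * c n * (2 / x) powr \<alpha>"
      using char_simple_stable_integral_diff(2)[OF M \<alpha> s t] that \<alpha>
      by (intro stable_tail_bound Q.real_distribution_distr U) (auto simp: U_def[abs_def] c_def)
    then show ?thesis by (simp add: measure_distr vimage_def Int_def conj_commute)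
  qed
  \<comment> \<open>The integral of the zero function is an empty sum.\<close>
  have [measurable]: "(\<lambda>\<omega>. ?S (s n) \<omega>) \<in> borel_measurable Q" "(\<lambda>\<omega>. ?S (t n) \<omega>) \<in> borel_measurable Q" for n
    using char_simple_stable_integral_diff(1)[OF M \<alpha> s[of n], of "\<lambda>_. 0"]
      char_simple_stable_integral_diff(1)[OF M \<alpha> t[of n], of "\<lambda>_. 0"]
    by (auto simp: in_Lp_def simple_stable_integral_def[of _ _ "\<lambda>_. 0"] image_constant_conv split: if_splits)
  have "measure Q {\<omega> \<in> space Q. 3 * \<epsilon> < \<bar>I \<omega> - J \<omega>\<bar>} \<le> 0" if \<epsilon>: "0 < \<epsilon>" for \<epsilon>
  proof (rule LIMSEQ_le_const)
    show "(\<lambda>n. measure Q {\<omega> \<in> space Q. \<bar>?S (s n) \<omega> - I \<omega>\<bar> > \<epsilon>} + 2 * c n * (2 / \<epsilon>) powr \<alpha> +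
        measure Q {\<omega> \<in> space Q. \<bar>?S (t n) \<omega> - J \<omega>\<bar> > \<epsilon>}) \<longlonglongrightarrow> 0"
      using tendsto_add[OF tendsto_add[OF sI[OF \<epsilon>] tendsto_mult_right[OF tendsto_mult_left[OF c0, of 2], of "(2 / \<epsilon>) powr \<alpha>"]] tJ[OF \<epsilon>]]
      by simp
    show "\<exists>N. \<forall>n\<ge>N. measure Q {\<omega> \<in> space Q. 3 * \<epsilon> < \<bar>I \<omega> - J \<omega>\<bar>} \<le>
        measure Q {\<omega> \<in> space Q. \<bar>?S (s n) \<omega> - I \<omega>\<bar> > \<epsilon>} + 2 * c n * (2 / \<epsilon>) powr \<alpha> +
        measure Q {\<omega> \<in> space Q. \<bar>?S (t n) \<omega> - J \<omega>\<bar> > \<epsilon>}"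
    proof (intro exI allI impI)
      fix n :: nat
      let ?A = "{\<omega> \<in> space Q. \<bar>?S (s n) \<omega> - I \<omega>\<bar> > \<epsilon>}" and ?B = "{\<omega> \<in> space Q. \<epsilon> < \<bar>U n \<omega>\<bar>}"
        and ?C = "{\<omega> \<in> space Q. \<bar>?S (t n) \<omega> - J \<omega>\<bar> > \<epsilon>}"
      have "measure Q {\<omega> \<in> space Q. 3 * \<epsilon> < \<bar>I \<omega> - J \<omega>\<bar>} \<le> measure Q (?A \<union> ?B \<union> ?C)"
        by (intro Q.finite_measure_mono) (auto simp: U_def)
      also have "\<dots> \<le> measure Q ?A + measure Q ?B + measure Q ?C"
        by (intro order_trans[OF measure_Un_le] add_right_mono measure_Un_le) auto
      finally show "measure Q {\<omega> \<in> space Q. 3 * \<epsilon> < \<bar>I \<omega> - J \<omega>\<bar>} \<le>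
          measure Q ?A + 2 * c n * (2 / \<epsilon>) powr \<alpha> + measure Q ?C"
        using tail[OF \<epsilon>, of n] by simp
    qed
  qed
  then have null: "AE \<omega> in Q. \<bar>I \<omega> - J \<omega>\<bar> \<le> 3 * \<epsilon>" if "0 < \<epsilon>" for \<epsilon>
    using that by (subst AE_iff_measurable[OF _ refl])
      (auto simp: not_le Q.emeasure_eq_measure measure_le_0_iff)
  have "AE \<omega> in Q. \<forall>k::nat. \<bar>I \<omega> - J \<omega>\<bar> \<le> 3 * (1 / real (Suc k))"
    unfolding AE_all_countable by (intro allI null) simp
  then show ?thesis
  proof eventually_elim
    case (elim \<omega>)
    have "(\<lambda>k. 3 * (1 / real (Suc k))) \<longlonglongrightarrow> 3 * 0"
      by (intro tendsto_intros LIMSEQ_Suc lim_1_over_n)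
    then have "\<bar>I \<omega> - J \<omega>\<bar> \<le> 3 * 0"
      by (rule LIMSEQ_le_const) (use elim in auto)
    then show ?case by simp
  qed
qed

section \<open>Coordinates on the transformation group\<close>

lemma additive_int_vec_bounded:
  fixes L :: "int ^ 'd \<Rightarrow> int"
  assumes add: "\<And>t u. L (t + u) = L t + L u"
  shows "\<exists>K::nat. \<forall>t b. (\<forall>j. \<bar>t $ j\<bar> \<le> b) \<longrightarrow> \<bar>L t\<bar> \<le> int K * b"
proof -
  interpret L: Modules.additive L by standard (rule add)
  have axis: "L (axis j k) = k * L (axis j 1)" for j k
  proof -
    interpret l: Modules.additive "\<lambda>k. L (axis j k)"
      by standard (auto simp: add[symmetric] vec_eq_iff axis_def intro!: arg_cong[where f=L])
    show ?thesis
    proof (induction k rule: int_induct[where k=0])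
      case base then show ?case by (simp add: l.zero)
    next
      case (step1 i) then show ?case by (simp add: l.add distrib_right)
    next
      case (step2 i) then show ?case by (simp add: l.diff left_diff_distrib)
    qed
  qed
  define K where "K = nat (\<Sum>j\<in>UNIV. \<bar>L (axis j 1)\<bar>)"
  have "\<bar>L t\<bar> \<le> int K * b" if b: "\<forall>j. \<bar>t $ j\<bar> \<le> b" for t b
  proof -
    have "(\<Sum>j\<in>UNIV. axis j (t $ j)) = t"
      by (simp add: vec_eq_iff axis_def if_distrib sum.delta cong: if_cong)
    then have "L t = (\<Sum>j\<in>UNIV. L (axis j (t $ j)))"
      using L.sum[of "\<lambda>j. axis j (t $ j)" UNIV] by simp
    also have "\<dots> = (\<Sum>j\<in>UNIV. t $ j * L (axis j 1))"
      by (intro sum.cong refl axis)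
    also have "\<bar>\<dots>\<bar> \<le> (\<Sum>j\<in>UNIV. \<bar>t $ j * L (axis j 1)\<bar>)"
      by (rule sum_abs)
    also have "\<dots> \<le> (\<Sum>j\<in>UNIV. b * \<bar>L (axis j 1)\<bar>)"
      using b by (intro sum_mono) (auto simp: abs_mult intro: mult_right_mono)
    also have "\<dots> = int K * b"
      by (simp add: K_def sum_distrib_left[symmetric] sum_nonneg mult.commute)
    finally show ?thesis .
  qed
  then show ?thesis by blast
qed

locale lattice_action =
  fixes S :: "'s measure" and \<phi> :: "int ^ 'd \<Rightarrow> 's \<Rightarrow> 's"
  assumes ns: "nonsingular_action S \<phi>"
begin

lemma phi_space: "s \<in> space S \<Longrightarrow> \<phi> t s \<in> space S"
  using ns by (auto simp: nonsingular_action_def dest: measurable_space)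

lemma phi_zero: "s \<in> space S \<Longrightarrow> \<phi> 0 s = s"
  using ns by (simp add: nonsingular_action_def)

lemma phi_add: "s \<in> space S \<Longrightarrow> \<phi> (u + v) s = \<phi> u (\<phi> v s)"
  using ns by (simp add: nonsingular_action_def)

lemma action_map_Bij: "action_map S \<phi> t \<in> Bij (space S)"
proof -
  have "\<phi> (- t) (\<phi> t s) = s" "\<phi> t (\<phi> (- t) s) = s" if "s \<in> space S" for s
    using phi_add[OF that, of "- t" t] phi_add[OF that, of t "- t"] phi_zero[OF that] by auto
  then have "bij_betw (\<phi> t) (space S) (space S)"
    by (intro bij_betw_byWitness[where f'="\<phi> (- t)"]) (auto simp: phi_space)
  then show ?thesis
    by (simp add: Bij_def action_map_def cong: bij_betw_cong)
qed

lemma action_map_add: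
  "action_map S \<phi> t \<otimes>\<^bsub>transformation_group S \<phi>\<^esub> action_map S \<phi> u = action_map S \<phi> (t + u)"
  using action_map_Bij[of t] action_map_Bij[of u]
  by (auto simp: transformation_group_def BijGroup_def compose_def action_map_def phi_add phi_space
      intro!: restrict_ext)

lemma action_map_zero: "\<one>\<^bsub>transformation_group S \<phi>\<^esub> = action_map S \<phi> 0"
  by (auto simp: transformation_group_def BijGroup_def action_map_def phi_zero intro!: restrict_ext)

lemma carrier_transformation_group: "carrier (transformation_group S \<phi>) = range (action_map S \<phi>)"
  by (simp add: transformation_group_def)

lemma comm_group_transformation_group: "comm_group (transformation_group S \<phi>)"
proof (rule comm_groupI)
  fix x assume "x \<in> carrier (transformation_group S \<phi>)"
  then obtain t where "x = action_map S \<phi> t" by (auto simp: carrier_transformation_group)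
  then show "\<exists>y\<in>carrier (transformation_group S \<phi>). y \<otimes>\<^bsub>transformation_group S \<phi>\<^esub> x = \<one>\<^bsub>transformation_group S \<phi>\<^esub>"
    by (intro bexI[of _ "action_map S \<phi> (- t)"]) (auto simp: carrier_transformation_group action_map_add action_map_zero)
qed (auto simp: carrier_transformation_group action_map_add action_map_zero add_ac)

text \<open>The coordinates of \<open>\<phi>\<^sub>t\<close> in the free summand are additive in \<open>t\<close> because the decomposition of a group
element along the two summands is unique. Together with the component in the finite summand they
determine \<open>\<phi>\<^sub>t\<close>.\<close>

lemma finite_rank_coordinates:
  assumes "free_part_lift S \<phi> p F"
  obtains L :: "nat \<Rightarrow> int ^ 'd \<Rightarrow> int" and \<nu> :: "int ^ 'd \<Rightarrow> 's \<Rightarrow> 's"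
  where "\<forall>i t u. L i (t + u) = L i t + L i u" and "finite (range \<nu>)"
    and "\<forall>t u. (\<forall>i<p. L i t = L i u) \<longrightarrow> \<nu> t = \<nu> u \<longrightarrow> (\<forall>s\<in>space S. \<phi> t s = \<phi> u s)"
proof -
  define A where "A = transformation_group S \<phi>"
  interpret A: comm_group A unfolding A_def by (rule comm_group_transformation_group)
  obtain Fb Nb where Fb: "subgroup Fb A" and Nb: "subgroup Nb A"
    and prod: "Fb <#>\<^bsub>A\<^esub> Nb = carrier A" and int: "Fb \<inter> Nb = {\<one>\<^bsub>A\<^esub>}"
    and iso: "A\<lparr>carrier := Fb\<rparr> \<cong> free_Abelian_group {..<p}" and fin: "finite Nb"
    using assms unfolding free_part_lift_def A_def[symmetric] Let_def by blast
  obtain h where h: "h \<in> iso (A\<lparr>carrier := Fb\<rparr>) (free_Abelian_group {..<p})"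
    using iso by (auto simp: is_iso_def)
  have am: "action_map S \<phi> t \<in> carrier A" for t
    by (simp add: A_def carrier_transformation_group)
  have "\<exists>x y. x \<in> Fb \<and> y \<in> Nb \<and> action_map S \<phi> t = x \<otimes>\<^bsub>A\<^esub> y" for t
    using am[of t] unfolding prod[symmetric] by (auto simp: set_mult_def)
  then obtain g \<nu> where g: "\<And>t. g t \<in> Fb" and \<nu>: "\<And>t. \<nu> t \<in> Nb"
    and am_eq: "\<And>t. action_map S \<phi> t = g t \<otimes>\<^bsub>A\<^esub> \<nu> t"
    by metis
  note [simp] = subgroup.mem_carrier[OF Fb] subgroup.mem_carrier[OF Nb] g \<nu>
  have uniq: "x = x'" if "x \<in> Fb" "x' \<in> Fb" "y \<in> Nb" "y' \<in> Nb" "x \<otimes>\<^bsub>A\<^esub> y = x' \<otimes>\<^bsub>A\<^esub> y'" for x x' y y'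
  proof -
    have "inv\<^bsub>A\<^esub> x' \<otimes>\<^bsub>A\<^esub> x = inv\<^bsub>A\<^esub> x' \<otimes>\<^bsub>A\<^esub> ((x \<otimes>\<^bsub>A\<^esub> y) \<otimes>\<^bsub>A\<^esub> inv\<^bsub>A\<^esub> y)"
      using that(1-4) by (simp add: A.m_assoc)
    also have "\<dots> = inv\<^bsub>A\<^esub> x' \<otimes>\<^bsub>A\<^esub> ((x' \<otimes>\<^bsub>A\<^esub> y') \<otimes>\<^bsub>A\<^esub> inv\<^bsub>A\<^esub> y)"
      using that by simp
    also have "\<dots> = y' \<otimes>\<^bsub>A\<^esub> inv\<^bsub>A\<^esub> y"
      using that(1-4) by (simp add: A.m_assoc[symmetric])
    finally have e: "inv\<^bsub>A\<^esub> x' \<otimes>\<^bsub>A\<^esub> x = y' \<otimes>\<^bsub>A\<^esub> inv\<^bsub>A\<^esub> y" .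
    moreover have "inv\<^bsub>A\<^esub> x' \<otimes>\<^bsub>A\<^esub> x \<in> Fb" "y' \<otimes>\<^bsub>A\<^esub> inv\<^bsub>A\<^esub> y \<in> Nb"
      using that Fb Nb by (simp_all add: subgroup.m_closed subgroup.m_inv_closed)
    ultimately have "inv\<^bsub>A\<^esub> x' \<otimes>\<^bsub>A\<^esub> x = \<one>\<^bsub>A\<^esub>" using int by auto
    then have "inv\<^bsub>A\<^esub> x = inv\<^bsub>A\<^esub> x'"
      using that(1,2) by (intro A.inv_equality) auto
    then show ?thesis
      using that(1,2) by (metis A.inv_inv subgroup.mem_carrier[OF Fb])
  qed
  have g_add: "g (t + u) = g t \<otimes>\<^bsub>A\<^esub> g u" for t u
  proof (rule uniq)
    show "g (t + u) \<otimes>\<^bsub>A\<^esub> \<nu> (t + u) = g t \<otimes>\<^bsub>A\<^esub> g u \<otimes>\<^bsub>A\<^esub> (\<nu> t \<otimes>\<^bsub>A\<^esub> \<nu> u)"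
      unfolding am_eq[symmetric] action_map_add[of t u, symmetric] A_def[symmetric]
      by (simp add: am_eq A.m_ac)
  qed (auto intro: subgroup.m_closed[OF Fb] subgroup.m_closed[OF Nb])
  define L where "L i t = Poly_Mapping.lookup (h (g t)) i" for i t
  have h_add: "h (x \<otimes>\<^bsub>A\<^esub> y) = h x + h y" if "x \<in> Fb" "y \<in> Fb" for x y
    using h that by (auto simp: iso_def hom_def free_Abelian_group_def)
  have h_keys: "Poly_Mapping.keys (h x) \<subseteq> {..<p}" if "x \<in> Fb" for x
    using h that by (auto simp: iso_def hom_def free_Abelian_group_def)
  have h_inj: "inj_on h Fb"
    using h by (auto simp: iso_def bij_betw_def)
  show ?thesis
  proof (rule that; (intro allI impI ballI)?)
    show "L i (t + u) = L i t + L i u" for i t u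
      by (simp add: L_def g_add h_add lookup_add)
    show "finite (range \<nu>)"
      by (rule finite_subset[OF _ fin]) auto
    fix t u s assume L: "\<forall>i<p. L i t = L i u" and nu: "\<nu> t = \<nu> u" and s: "s \<in> space S"
    have "h (g t) = h (g u)"
    proof (rule poly_mapping_eqI)
      fix i show "Poly_Mapping.lookup (h (g t)) i = Poly_Mapping.lookup (h (g u)) i"
      proof (cases "i < p")
        case True then show ?thesis using L by (simp add: L_def)
      next
        case False
        then have "i \<notin> Poly_Mapping.keys (h (g t))" "i \<notin> Poly_Mapping.keys (h (g u))"
          using h_keys[OF g[of t]] h_keys[OF g[of u]] by auto
        then show ?thesis by (simp add: in_keys_iff)
      qed
    qed
    then have "g t = g u" using h_inj by (auto dest: inj_onD)
    then have "action_map S \<phi> t = action_map S \<phi> u" by (simp add: am_eq nu)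
    then show "\<phi> t s = \<phi> u s"
      using s by (metis action_map_def restrict_apply')
  qed
qed

end

section \<open>Coincidences in the increment fields\<close>

text \<open>With \<open>k = q - q'\<close>, the transformation \<open>\<phi>\<^sub>k\<close> is the identity, so the cocycle is a homomorphism into
\<open>{-1, 1}\<close> along the multiples of \<open>k\<close> and is trivial at \<open>2 k\<close>. Passing to \<open>2 k\<close> is what makes the signs,
and not only the absolute values of the integrands, agree.\<close>

lemma stable_integrand_periodic:
  fixes S :: "'s measure" and \<phi> :: "int ^ 'd \<Rightarrow> 's \<Rightarrow> 's"
  assumes ns: "nonsingular_action S \<phi>" and c: "sign_cocycle S \<phi> c"
    and k: "\<And>s. s \<in> space S \<Longrightarrow> \<phi> q s = \<phi> q' s" and s: "s \<in> space S"
  shows "c (q + q + r) s * enn2real (RN_deriv S (shifted_measure S \<phi> (q + q + r)) s) powr (1 / \<alpha>) * f (\<phi> (q + q + r) s) =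
    c (q' + q' + r) s * enn2real (RN_deriv S (shifted_measure S \<phi> (q' + q' + r)) s) powr (1 / \<alpha>) * f (\<phi> (q' + q' + r) s)"
proof -
  interpret lattice_action S \<phi> by standard (rule ns)
  have c_add: "c (u + v) s = c u (\<phi> v s) * c v s" if "s \<in> space S" for u v s
    using c that by (simp add: sign_cocycle_def)
  have c_sq: "c t s * c t s = 1" if "s \<in> space S" for t s
  proof -
    have "c t s \<in> {- 1, 1}" using c that by (simp add: sign_cocycle_def)
    then show ?thesis by auto
  qed
  define k where "k = q - q'"
  have "\<phi> k s = s" if "s \<in> space S" for s
  proof -
    have "\<phi> k s = \<phi> q (\<phi> (- q') s)" using phi_add[OF that, of q "- q'"] by (simp add: k_def)
    also have "\<dots> = \<phi> q' (\<phi> (- q') s)" using that by (intro assms phi_space)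
    also have "\<dots> = \<phi> 0 s" using phi_add[OF that, of q' "- q'"] by simp
    finally show ?thesis using phi_zero[OF that] by simp
  qed
  then have kk: "\<phi> (k + k) s = s" "c (k + k) s = 1" if "s \<in> space S" for s
    using that phi_add[OF that, of k k] c_add[OF that, of k k] c_sq[OF that, of k] by simp_all
  define u where "u = q' + q' + r"
  have u: "q + q + r = u + (k + k)" by (simp add: u_def k_def)
  have phi: "\<phi> (u + (k + k)) s = \<phi> u s" if "s \<in> space S" for s
    using phi_add[OF that, of u "k + k"] kk(1)[OF that] by simp
  have "\<phi> (- (u + (k + k))) s = \<phi> (- u) s" if "s \<in> space S" for s
  proof -
    have "\<phi> (- u) s = \<phi> (- (u + (k + k)) + (k + k)) s" by simp
    also have "\<dots> = \<phi> (- (u + (k + k))) (\<phi> (k + k) s)"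
      by (rule phi_add[OF that])
    also have "\<dots> = \<phi> (- (u + (k + k))) s"
      by (simp only: kk(1)[OF that])
    finally show ?thesis by simp
  qed
  then have "shifted_measure S \<phi> (u + (k + k)) = shifted_measure S \<phi> u"
    unfolding shifted_measure_def by (intro distr_cong) auto
  then show ?thesis
    unfolding u u_def[symmetric] using phi[OF s] c_add[OF s, of u "k + k"] kk[OF s] by simp
qed

text \<open>Indices of the dyadic points of level \<open>n\<close> in the cube \<open>[-2, 2]\<^sup>d\<close>. The unit cube is enlarged because the
points of a separating set that approximate a boundary point may all lie outside it.\<close>

definition grid :: "nat \<Rightarrow> (int ^ 'd) set" where
  "grid n = {t. \<forall>j. \<bar>t $ j\<bar> \<le> 2 ^ (n + 1)}"

lemma finite_grid: "finite (grid n :: (int ^ 'd) set)"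
proof (rule finite_subset)
  show "(grid n :: (int ^ 'd) set) \<subseteq> vec_lambda ` (UNIV \<rightarrow>\<^sub>E {- (2 ^ (n + 1)) .. 2 ^ (n + 1)})"
  proof
    fix t :: "int ^ 'd" assume "t \<in> grid n"
    then show "t \<in> vec_lambda ` (UNIV \<rightarrow>\<^sub>E {- (2 ^ (n + 1)) .. 2 ^ (n + 1)})"
      by (intro image_eqI[of _ _ "\<lambda>j. t $ j"]) (auto simp: grid_def abs_le_iff minus_le_iff)
  qed
qed (intro finite_imageI finite_PiE; simp)

text \<open>The class \<open>\<kappa> t\<close> records the parity of \<open>t\<close> and the coordinates of \<open>\<phi>\<close> at \<open>t div 2\<close>. Two indices of
the same class are \<open>2 q + r\<close> and \<open>2 q' + r\<close> with \<open>\<phi>\<close> equal at \<open>q\<close> and \<open>q'\<close>, so the integrands coincide.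
On the grid each of the \<open>p\<close> free coordinates takes \<open>O(2\<^sup>n)\<close> values, and the remaining data are finite.\<close>

lemma generated_field_classes:
  fixes Y :: "int ^ 'd \<Rightarrow> 'w \<Rightarrow> real" and S :: "'s measure"
  assumes dim: "has_effective_dimension \<alpha> P Y S \<phi> R N p" and \<alpha>: "0 < \<alpha>"
  obtains \<kappa> :: "int ^ 'd \<Rightarrow> ('d \<Rightarrow> bool) \<times> int list \<times> ('s \<Rightarrow> 's)" and C :: nat
  where "\<forall>t u. \<kappa> t = \<kappa> u \<longrightarrow> (AE \<omega> in P. Y t \<omega> = Y u \<omega>)"
    and "\<forall>n. card (\<kappa> ` grid n) \<le> C * 2 ^ (n * p)"
proof -
  from dim obtain F where gen: "generated_by \<alpha> P Y S \<phi> R N" and F: "free_part_lift S \<phi> p F"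
    by (auto simp: has_effective_dimension_def)
  have ns: "nonsingular_action S \<phi>"
    using gen unfolding generated_by_def by (rule conjunct1)
  from gen[unfolded generated_by_def, THEN conjunct2] obtain f c where c: "sign_cocycle S \<phi> c"
    and rep: "stable_integral_representation \<alpha> P Y R S N
      (\<lambda>t s. c t s * enn2real (RN_deriv S (shifted_measure S \<phi> t) s) powr (1 / \<alpha>) * f (\<phi> t s))"
    by (elim conjE exE) (rule that; assumption)
  interpret lattice_action S \<phi> by standard (rule ns)
  obtain L :: "nat \<Rightarrow> int ^ 'd \<Rightarrow> int" and \<nu> :: "int ^ 'd \<Rightarrow> 's \<Rightarrow> 's" where L: "\<forall>i t u. L i (t + u) = L i t + L i u" and \<nu>: "finite (range \<nu>)"
    and coord: "\<forall>t u. (\<forall>i<p. L i t = L i u) \<longrightarrow> \<nu> t = \<nu> u \<longrightarrow> (\<forall>s\<in>space S. \<phi> t s = \<phi> u s)"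
    by (rule finite_rank_coordinates[OF F])
  define half :: "int ^ 'd \<Rightarrow> int ^ 'd" where "half t = (\<chi> j. t $ j div 2)" for t
  define \<kappa> where "\<kappa> t = (\<lambda>j. odd (t $ j), map (\<lambda>i. L i (half t)) [0..<p], \<nu> (half t))" for t
  have "\<exists>K::nat. \<forall>t b. (\<forall>j. \<bar>t $ j\<bar> \<le> b) \<longrightarrow> \<bar>L i t\<bar> \<le> int K * b" for i
    using L by (intro additive_int_vec_bounded) auto
  then obtain k where k: "\<And>i t b. (\<And>j. \<bar>t $ j\<bar> \<le> b) \<Longrightarrow> \<bar>L i t\<bar> \<le> int (k i) * b"
    by metis
  define K where "K = (\<Sum>i<p. k i)"
  have K: "\<bar>L i t\<bar> \<le> int K * b" if "i < p" "\<And>j. \<bar>t $ j\<bar> \<le> b" for i t b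
  proof -
    have "k i \<le> K" unfolding K_def using that by (intro member_le_sum) auto
    moreover have "0 \<le> b" using that(2)[of undefined] by linarith
    ultimately have "int (k i) * b \<le> int K * b" by (intro mult_right_mono) auto
    moreover have "\<bar>L i t\<bar> \<le> int (k i) * b" by (intro k that(2))
    ultimately show ?thesis by linarith
  qed
  define C where "C = CARD('d \<Rightarrow> bool) * (4 * K + 1) ^ p * card (range \<nu>)"
  show ?thesis
  proof (rule that; intro allI impI)
    fix t u assume "\<kappa> t = \<kappa> u"
    then have par: "odd (t $ j) = odd (u $ j)" and eqL: "i < p \<Longrightarrow> L i (half t) = L i (half u)"
      and eq\<nu>: "\<nu> (half t) = \<nu> (half u)" for i j
      by (auto simp: \<kappa>_def dest: fun_cong)
    define r :: "int ^ 'd" where "r = (\<chi> j. t $ j mod 2)"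
    have "t $ j = t $ j div 2 + t $ j div 2 + t $ j mod 2" "u $ j = u $ j div 2 + u $ j div 2 + t $ j mod 2" for j
      using par[of j] by presburger+
    then have t: "t = half t + half t + r" and u: "u = half u + half u + r"
      by (simp_all add: vec_eq_iff half_def r_def)
    have same: "\<phi> (half t) s = \<phi> (half u) s" if "s \<in> space S" for s
      using coord eqL eq\<nu> that by blast
    obtain I where M: "sas_random_measure \<alpha> R S N" and fdd: "eq_fdd P Y R I"
      and I: "\<And>t. has_stable_integral \<alpha> R S N
        (\<lambda>s. c t s * enn2real (RN_deriv S (shifted_measure S \<phi> t) s) powr (1 / \<alpha>) * f (\<phi> t s)) (I t)"
      using rep unfolding stable_integral_representation_def by (elim conjE exE) (rule that; auto)
    have "AE \<omega> in R. I t \<omega> = I u \<omega>"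
    proof (rule has_stable_integral_unique[OF M \<alpha> I I])
      fix s assume "s \<in> space S"
      then show "c t s * enn2real (RN_deriv S (shifted_measure S \<phi> t) s) powr (1 / \<alpha>) * f (\<phi> t s) =
          c u s * enn2real (RN_deriv S (shifted_measure S \<phi> u) s) powr (1 / \<alpha>) * f (\<phi> u s)"
        using stable_integrand_periodic[OF ns c same, of s r \<alpha> f, folded t u] by blast
    qed
    moreover have mI: "I i \<in> borel_measurable R" and mY: "Y i \<in> borel_measurable P" for i
      using fdd by (auto simp: eq_fdd_def random_field_def)
    ultimately have "emeasure R {\<omega> \<in> space R. 0 < \<bar>I t \<omega> - I u \<omega>\<bar>} = 0"
      by (subst (asm) AE_iff_measurable[OF _ refl]) (auto cong: conj_cong)
    then have z: "measure P {\<omega> \<in> space P. 0 < \<bar>Y t \<omega> - Y u \<omega>\<bar>} = 0"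
      unfolding eq_fdd_increment[OF fdd] by (simp add: measure_def)
    interpret P: prob_space P using fdd by (simp add: eq_fdd_def random_field_def)
    have "AE \<omega> in P. \<not> (0 < \<bar>Y t \<omega> - Y u \<omega>\<bar>)"
      using z mY by (subst AE_iff_measurable[OF _ refl]) (auto simp: P.emeasure_eq_measure)
    then show "AE \<omega> in P. Y t \<omega> = Y u \<omega>" by simp
  next
    fix n
    define b :: int where "b = 2 ^ (n + 1)"
    define B where "B = int K * b"
    have b: "0 \<le> b" by (simp add: b_def)
    have half: "\<bar>half t $ j\<bar> \<le> b" if "t \<in> grid n" for t j
    proof -
      have "\<bar>t $ j\<bar> \<le> b" using that by (simp add: grid_def b_def)
      then show ?thesis by (simp add: half_def)
    qed
    have "\<kappa> ` grid n \<subseteq> UNIV \<times> {xs. set xs \<subseteq> {-B..B} \<and> length xs = p} \<times> range \<nu>"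
    proof (rule image_subsetI)
      fix t :: "int ^ 'd" assume "t \<in> grid n"
      then have "\<bar>L i (half t)\<bar> \<le> B" if "i < p" for i
        using K[OF that half] by (simp add: B_def)
      then have "L i (half t) \<in> {-B..B}" if "i < p" for i
        using that by (force simp: abs_le_iff)
      then show "\<kappa> t \<in> UNIV \<times> {xs. set xs \<subseteq> {-B..B} \<and> length xs = p} \<times> range \<nu>"
        by (auto simp: \<kappa>_def)
    qed
    then have "card (\<kappa> ` grid n) \<le> card ((UNIV :: ('d \<Rightarrow> bool) set) \<times> {xs. set xs \<subseteq> {-B..B} \<and> length xs = p} \<times> range \<nu>)"
      using \<nu> by (intro card_mono finite_cartesian_product) (auto intro: finite_lists_length_eq)
    also have "\<dots> = CARD('d \<Rightarrow> bool) * nat (2 * B + 1) ^ p * card (range \<nu>)"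
      by (simp add: card_cartesian_product card_lists_length_eq)
    also have "nat (2 * B + 1) \<le> (4 * K + 1) * 2 ^ n"
    proof -
      have "nat (2 * B + 1) = 4 * K * 2 ^ n + 1"
        by (simp add: B_def b_def nat_add_distrib nat_mult_distrib nat_power_eq)
      then show ?thesis by simp
    qed
    also have "CARD('d \<Rightarrow> bool) * ((4 * K + 1) * 2 ^ n) ^ p * card (range \<nu>) = C * 2 ^ (n * p)"
      by (simp only: C_def power_mult_distrib power_mult mult_ac)
    finally show "card (\<kappa> ` grid n) \<le> C * 2 ^ (n * p)"
      by (simp add: mult_le_mono power_mono)
  qed
qed

lemma (in prob_space) prob_Ex_le_classes:
  fixes Y :: "'i \<Rightarrow> 'a \<Rightarrow> real" and b :: real
  assumes fin: "finite B" and Y: "\<And>t. random_variable borel (Y t)"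
    and cls: "\<And>t u. \<kappa> t = \<kappa> u \<Longrightarrow> AE \<omega> in M. Y t \<omega> = Y u \<omega>"
    and bound: "\<And>t. t \<in> B \<Longrightarrow> prob {\<omega> \<in> space M. x < \<bar>Y t \<omega>\<bar>} \<le> b"
  shows "prob {\<omega> \<in> space M. \<exists>t\<in>B. x < \<bar>Y t \<omega>\<bar>} \<le> card (\<kappa> ` B) * b"
proof -
  define r where "r = inv_into B \<kappa>"
  have r: "r (\<kappa> t) \<in> B" "\<kappa> (r (\<kappa> t)) = \<kappa> t" if "t \<in> B" for t
    using that by (auto simp: r_def inv_into_into f_inv_into_f)
  have [measurable]: "random_variable borel (Y t)" for t by (rule Y)
  have ev: "{\<omega> \<in> space M. x < \<bar>Y t \<omega>\<bar>} \<in> events" for t by simp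
  have "AE \<omega> in M. \<forall>t\<in>B. Y t \<omega> = Y (r (\<kappa> t)) \<omega>"
    using fin r(2) by (intro AE_finite_allI cls) auto
  then have "prob {\<omega> \<in> space M. \<exists>t\<in>B. x < \<bar>Y t \<omega>\<bar>} \<le> prob (\<Union>k\<in>\<kappa> ` B. {\<omega> \<in> space M. x < \<bar>Y (r k) \<omega>\<bar>})"
    using fin ev by (intro finite_measure_mono_AE sets.finite_UN) (auto elim!: eventually_mono)
  also have "\<dots> \<le> (\<Sum>k\<in>\<kappa> ` B. prob {\<omega> \<in> space M. x < \<bar>Y (r k) \<omega>\<bar>})"
    using fin ev by (intro finite_measure_subadditive_finite) auto
  also have "\<dots> \<le> (\<Sum>k\<in>\<kappa> ` B. b :: real)"
    using r by (intro sum_mono bound) auto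
  finally show ?thesis by simp
qed

section \<open>Increments along the dyadic grids\<close>

definition dyadic :: "nat \<Rightarrow> int ^ 'd \<Rightarrow> real ^ 'd" where
  "dyadic n t = (1 / 2 ^ n) *\<^sub>R vec_of_int t"

definition dyadic_floor :: "nat \<Rightarrow> real ^ 'd \<Rightarrow> int ^ 'd" where
  "dyadic_floor n s = (\<chi> j. \<lfloor>2 ^ n * s $ j\<rfloor>)"

lemma vec_of_int_add: "vec_of_int (t + u) = vec_of_int t + vec_of_int u"
  by (simp add: vec_of_int_def vec_eq_iff)

lemma sas_increment_tail:
  assumes X: "sas_field \<alpha> P X" and \<alpha>: "0 < \<alpha>"
  obtains C where "0 \<le> C" "\<forall>x>0. measure P {\<omega> \<in> space P. x < \<bar>X s \<omega> - X t \<omega>\<bar>} \<le> C * x powr - \<alpha>"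
proof (cases "s = t")
  case True
  then show ?thesis by (intro that[of 0]) auto
next
  case False
  interpret prob_space P using X by (simp add: sas_field_def random_field_def)
  have [measurable]: "random_variable borel (X i)" for i
    using X by (simp add: sas_field_def random_field_def)
  define D where "D = distr P borel (\<lambda>\<omega>. X s \<omega> - X t \<omega>)"
  have "sas_distribution \<alpha> (distr P borel (\<lambda>\<omega>. \<Sum>i\<in>{s, t}. (if i = s then 1 else -1) * X i \<omega>))"
    using X[unfolded sas_field_def, THEN conjunct2, rule_format, of "{s, t}"] by simp
  then have "sas_distribution \<alpha> D"
    using False by (simp add: D_def)
  then obtain \<sigma> where \<sigma>: "0 \<le> \<sigma>" "\<And>\<theta>. char D \<theta> = complex_of_real (exp (- (\<sigma> powr \<alpha> * \<bar>\<theta>\<bar> powr \<alpha>)))"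
    unfolding sas_distribution_def by blast
  show ?thesis
  proof (rule that[of "2 * \<sigma> powr \<alpha> * 2 powr \<alpha>"]; (intro allI impI)?)
    fix x :: real assume x: "0 < x"
    have "measure D {y. x < \<bar>y\<bar>} \<le> 2 * \<sigma> powr \<alpha> * (2 / x) powr \<alpha>"
      using \<sigma> x \<alpha> unfolding D_def by (intro stable_tail_bound real_distribution_distr) auto
    also have "(2 / x) powr \<alpha> = 2 powr \<alpha> * x powr - \<alpha>"
      using x by (simp add: powr_divide powr_minus_divide)
    finally show "measure P {\<omega> \<in> space P. x < \<bar>X s \<omega> - X t \<omega>\<bar>} \<le> 2 * \<sigma> powr \<alpha> * 2 powr \<alpha> * x powr - \<alpha>"
      by (simp add: D_def measure_distr vimage_def Int_def conj_commute mult.assoc)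
  qed simp
qed

lemma stationary_increment_law:
  assumes "stationary_increments P X"
  shows "measure P {\<omega> \<in> space P. x < \<bar>X (t + u) \<omega> - X t \<omega>\<bar>} =
    measure P {\<omega> \<in> space P. x < \<bar>X u \<omega> - X 0 \<omega>\<bar>}"
proof -
  have "eq_fdd P (\<lambda>s \<omega>. X (s + t) \<omega> - X t \<omega>) P (\<lambda>s \<omega>. X s \<omega> - X 0 \<omega>)"
    using assms by (simp add: stationary_increments_def)
  from eq_fdd_increment[OF this, of x u 0] show ?thesis by (simp add: add.commute)
qed

locale self_similar_stable_field =
  fixes \<alpha> H :: real and P :: "'w measure" and X :: "real ^ 'd \<Rightarrow> 'w \<Rightarrow> real"
  assumes \<alpha>: "0 < \<alpha>" and H: "0 < H" and sas: "sas_field \<alpha> P X"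
    and ss: "self_similar H P X" and si: "stationary_increments P X"
begin

sublocale prob_space P
  using sas by (simp add: sas_field_def random_field_def)

lemma X_measurable[measurable]: "random_variable borel (X t)"
  using sas by (simp add: sas_field_def random_field_def)

lemma scaled_increments:
  assumes "finite E" "0 < c"
  shows "prob {\<omega> \<in> space P. \<exists>(a, b)\<in>E. x < \<bar>X (c *\<^sub>R a) \<omega> - X (c *\<^sub>R b) \<omega>\<bar>} =
    prob {\<omega> \<in> space P. \<exists>(a, b)\<in>E. x / c powr H < \<bar>X a \<omega> - X b \<omega>\<bar>}"
proof -
  have "eq_fdd P (\<lambda>t. X (c *\<^sub>R t)) P (\<lambda>t \<omega>. c powr H * X t \<omega>)"
    using ss assms by (simp add: self_similar_def)
  from eq_fdd_increments[OF this assms(1), of x] show ?thesis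
    using assms(2) by (simp add: right_diff_distrib[symmetric] abs_mult pos_divide_less_eq mult.commute)
qed

lemma axis_increment_tail:
  fixes j :: 'd
  obtains C where "0 \<le> C" "\<forall>t (c :: real) x h. 0 < x \<longrightarrow> \<bar>c\<bar> \<le> h \<longrightarrow>
    prob {\<omega> \<in> space P. x < \<bar>X (t + axis j c) \<omega> - X t \<omega>\<bar>} \<le> C * h powr (H * \<alpha>) * x powr - \<alpha>"
proof -
  obtain C1 where C1: "0 \<le> C1" "\<forall>x>0. prob {\<omega> \<in> space P. x < \<bar>X (axis j 1) \<omega> - X 0 \<omega>\<bar>} \<le> C1 * x powr - \<alpha>"
    using sas_increment_tail[OF sas \<alpha>, of "axis j 1" 0] .
  obtain C2 where C2: "0 \<le> C2" "\<forall>x>0. prob {\<omega> \<in> space P. x < \<bar>X (axis j (- 1)) \<omega> - X 0 \<omega>\<bar>} \<le> C2 * x powr - \<alpha>"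
    using sas_increment_tail[OF sas \<alpha>, of "axis j (- 1)" 0] .
  define C where "C = C1 + C2"
  have C: "0 \<le> C" using C1 C2 by (simp add: C_def)
  show ?thesis
  proof (rule that[OF C]; intro allI impI)
    fix t :: "real ^ 'd" and c x h :: real assume x: "0 < x" and h: "\<bar>c\<bar> \<le> h"
    show "prob {\<omega> \<in> space P. x < \<bar>X (t + axis j c) \<omega> - X t \<omega>\<bar>} \<le> C * h powr (H * \<alpha>) * x powr - \<alpha>"
    proof (cases "c = 0")
      case True
      then have z: "axis j c = 0" by (simp add: axis_def vec_eq_iff)
      show ?thesis unfolding z using x C by simp
    next
      case False
      define e :: "real ^ 'd" where "e = axis j (sgn c)"
      have e: "axis j c = \<bar>c\<bar> *\<^sub>R e"
        by (simp add: e_def axis_def vec_eq_iff abs_mult_sgn)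
      have y: "0 < x / \<bar>c\<bar> powr H" using x False by simp
      have "prob {\<omega> \<in> space P. x < \<bar>X (t + axis j c) \<omega> - X t \<omega>\<bar>} =
          prob {\<omega> \<in> space P. x < \<bar>X (\<bar>c\<bar> *\<^sub>R e) \<omega> - X (\<bar>c\<bar> *\<^sub>R 0) \<omega>\<bar>}"
        unfolding stationary_increment_law[OF si] e by simp
      also have "\<dots> = prob {\<omega> \<in> space P. x / \<bar>c\<bar> powr H < \<bar>X e \<omega> - X 0 \<omega>\<bar>}"
        using scaled_increments[of "{(e, 0)}" "\<bar>c\<bar>" x] False by simp
      also have "\<dots> \<le> C * (x / \<bar>c\<bar> powr H) powr - \<alpha>"
      proof (cases "0 < c")
        case True
        then have "prob {\<omega> \<in> space P. x / \<bar>c\<bar> powr H < \<bar>X e \<omega> - X 0 \<omega>\<bar>} \<le> C1 * (x / \<bar>c\<bar> powr H) powr - \<alpha>"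
          using C1(2)[rule_format, OF y] by (simp add: e_def)
        also have "\<dots> \<le> C * (x / \<bar>c\<bar> powr H) powr - \<alpha>"
          using C2 by (intro mult_right_mono) (auto simp: C_def)
        finally show ?thesis .
      next
        case neg: False
        then have "prob {\<omega> \<in> space P. x / \<bar>c\<bar> powr H < \<bar>X e \<omega> - X 0 \<omega>\<bar>} \<le> C2 * (x / \<bar>c\<bar> powr H) powr - \<alpha>"
          using C2(2)[rule_format, OF y] False by (simp add: e_def)
        also have "\<dots> \<le> C * (x / \<bar>c\<bar> powr H) powr - \<alpha>"
          using C1 by (intro mult_right_mono) (auto simp: C_def)
        finally show ?thesis .
      qed
      also have "(x / \<bar>c\<bar> powr H) powr - \<alpha> = \<bar>c\<bar> powr (H * \<alpha>) * x powr - \<alpha>"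
        using x by (simp add: powr_divide powr_powr powr_minus_divide)
      also have "C * (\<bar>c\<bar> powr (H * \<alpha>) * x powr - \<alpha>) \<le> C * (h powr (H * \<alpha>) * x powr - \<alpha>)"
        using C h \<alpha> H by (intro mult_left_mono mult_right_mono powr_mono2) auto
      finally show ?thesis by (simp add: mult.assoc)
    qed
  qed
qed

text \<open>Self-similarity relates only increments along the same ray, so an arbitrary increment is split into
steps along the coordinate axes. The constant may depend on the set \<open>J\<close> of axes.\<close>

lemma increment_tail_supported:
  assumes "finite J"
  shows "\<exists>C\<ge>0. \<forall>t u x h. 0 < x \<longrightarrow> (\<forall>j. \<bar>u $ j\<bar> \<le> h \<and> (j \<notin> J \<longrightarrow> u $ j = 0)) \<longrightarrow>
    prob {\<omega> \<in> space P. x < \<bar>X (t + u) \<omega> - X t \<omega>\<bar>} \<le> C * h powr (H * \<alpha>) * x powr - \<alpha>"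
  using assms
proof (induction J)
  case empty
  show ?case
  proof (intro exI[of _ 0] conjI allI impI)
    fix t u :: "real ^ 'd" and x h :: real
    assume "0 < x" "\<forall>j. \<bar>u $ j\<bar> \<le> h \<and> (j \<notin> {} \<longrightarrow> u $ j = 0)"
    then have "u = 0" by (simp add: vec_eq_iff)
    then show "prob {\<omega> \<in> space P. x < \<bar>X (t + u) \<omega> - X t \<omega>\<bar>} \<le> 0 * h powr (H * \<alpha>) * x powr - \<alpha>"
      using \<open>0 < x\<close> by simp
  qed simp
next
  case (insert j J)
  from insert.IH obtain C where C: "0 \<le> C" "\<forall>t u x h. 0 < x \<longrightarrow> (\<forall>j. \<bar>u $ j\<bar> \<le> h \<and> (j \<notin> J \<longrightarrow> u $ j = 0)) \<longrightarrow>
    prob {\<omega> \<in> space P. x < \<bar>X (t + u) \<omega> - X t \<omega>\<bar>} \<le> C * h powr (H * \<alpha>) * x powr - \<alpha>"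
    by blast
  obtain C' where C': "0 \<le> C'" "\<forall>t c x h. 0 < x \<longrightarrow> \<bar>c\<bar> \<le> h \<longrightarrow>
    prob {\<omega> \<in> space P. x < \<bar>X (t + axis j c) \<omega> - X t \<omega>\<bar>} \<le> C' * h powr (H * \<alpha>) * x powr - \<alpha>"
    using axis_increment_tail[of j] .
  show ?case
  proof (intro exI[of _ "(C + C') * (1 / 2) powr - \<alpha>"] conjI allI impI)
    show "0 \<le> (C + C') * (1 / 2) powr - \<alpha>" using C C' by simp
    fix t u :: "real ^ 'd" and x h :: real
    assume x: "0 < x" and u: "\<forall>i. \<bar>u $ i\<bar> \<le> h \<and> (i \<notin> insert j J \<longrightarrow> u $ i = 0)"
    define a where "a = axis j (u $ j)"
    define w where "w = (\<chi> i. if i = j then 0 else u $ i)"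
    have h: "0 \<le> h" using u abs_ge_zero order_trans by blast
    have taw: "t + u = (t + a) + w" by (auto simp: vec_eq_iff a_def w_def axis_def)
    have "{\<omega> \<in> space P. x < \<bar>X (t + u) \<omega> - X t \<omega>\<bar>} \<subseteq>
        {\<omega> \<in> space P. x / 2 < \<bar>X ((t + a) + w) \<omega> - X (t + a) \<omega>\<bar>} \<union> {\<omega> \<in> space P. x / 2 < \<bar>X (t + a) \<omega> - X t \<omega>\<bar>}"
      unfolding taw by auto (smt (verit))
    then have "prob {\<omega> \<in> space P. x < \<bar>X (t + u) \<omega> - X t \<omega>\<bar>} \<le>
        prob {\<omega> \<in> space P. x / 2 < \<bar>X ((t + a) + w) \<omega> - X (t + a) \<omega>\<bar>} +
        prob {\<omega> \<in> space P. x / 2 < \<bar>X (t + a) \<omega> - X t \<omega>\<bar>}"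
      by (intro order_trans[OF finite_measure_mono measure_Un_le]) auto
    also have "\<dots> \<le> C * h powr (H * \<alpha>) * (x / 2) powr - \<alpha> + C' * h powr (H * \<alpha>) * (x / 2) powr - \<alpha>"
      unfolding a_def using x u h by (intro add_mono C(2)[rule_format] C'(2)[rule_format]) (auto simp: w_def)
    also have "\<dots> = (C + C') * (1 / 2) powr - \<alpha> * h powr (H * \<alpha>) * x powr - \<alpha>"
      using x powr_mult[of x "1/2" "- \<alpha>"] by (simp add: algebra_simps)
    finally show "prob {\<omega> \<in> space P. x < \<bar>X (t + u) \<omega> - X t \<omega>\<bar>} \<le>
        (C + C') * (1 / 2) powr - \<alpha> * h powr (H * \<alpha>) * x powr - \<alpha>" .
  qed
qed

text \<open>The approximant differs from \<open>s\<close> by at most \<open>2\<^sup>-\<^sup>n\<close> in each coordinate, so the increment exceeds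
\<open>2\<^sup>-\<^sup>n\<^sup>H\<^sup>/\<^sup>2\<close> with a probability of order \<open>2\<^sup>-\<^sup>n\<^sup>H\<^sup>\<alpha>\<^sup>/\<^sup>2\<close>, which is summable.\<close>

lemma dyadic_approximation:
  "AE \<omega> in P. (\<lambda>n. X (dyadic n (dyadic_floor n s)) \<omega>) \<longlonglongrightarrow> X s \<omega>"
proof -
  obtain C where C: "\<forall>t u x h. 0 < x \<longrightarrow> (\<forall>j. \<bar>u $ j\<bar> \<le> h \<and> (j \<notin> UNIV \<longrightarrow> u $ j = 0)) \<longrightarrow>
    prob {\<omega> \<in> space P. x < \<bar>X (t + u) \<omega> - X t \<omega>\<bar>} \<le> C * h powr (H * \<alpha>) * x powr - \<alpha>"
    using increment_tail_supported[OF finite[of UNIV]] by blast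
  define x :: "nat \<Rightarrow> real" where "x n = (2 powr - (H / 2)) ^ n" for n
  define A where "A n = {\<omega> \<in> space P. x n < \<bar>X (dyadic n (dyadic_floor n s)) \<omega> - X s \<omega>\<bar>}" for n
  have A[measurable]: "A n \<in> events" for n by (simp add: A_def)
  have le: "prob (A n) \<le> C * (2 powr - (H * \<alpha> / 2)) ^ n" for n
  proof -
    define u where "u = dyadic n (dyadic_floor n s) - s"
    have "\<bar>u $ j\<bar> \<le> 1 / 2 ^ n" for j
    proof -
      have "u $ j = (of_int \<lfloor>2 ^ n * s $ j\<rfloor> - 2 ^ n * s $ j) / 2 ^ n"
        by (simp add: u_def dyadic_def dyadic_floor_def vec_of_int_def diff_divide_distrib)
      moreover have "\<bar>of_int \<lfloor>2 ^ n * s $ j\<rfloor> - 2 ^ n * s $ j\<bar> \<le> 1"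
        by linarith
      ultimately show ?thesis by (simp add: abs_divide divide_right_mono)
    qed
    then have "prob {\<omega> \<in> space P. x n < \<bar>X (s + u) \<omega> - X s \<omega>\<bar>} \<le> C * (1 / 2 ^ n) powr (H * \<alpha>) * x n powr - \<alpha>"
      by (intro C[rule_format]) (auto simp: x_def)
    also have "(1 / 2 ^ n) powr (H * \<alpha>) = (2 :: real) powr (- real n * (H * \<alpha>))"
      by (simp add: powr_minus_divide powr_powr powr_realpow[symmetric] powr_divide)
    also have "x n powr - \<alpha> = 2 powr (real n * (H * \<alpha> / 2))"
      by (simp add: x_def powr_powr powr_realpow[symmetric] algebra_simps)
    also have "C * 2 powr (- real n * (H * \<alpha>)) * 2 powr (real n * (H * \<alpha> / 2)) = C * (2 powr - (H * \<alpha> / 2)) ^ n"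
      by (simp add: powr_add[symmetric] powr_powr powr_realpow[symmetric] algebra_simps)
    finally show ?thesis by (simp add: A_def u_def)
  qed
  have q: "2 powr - (H * \<alpha> / 2) < 1" "2 powr - (H / 2) < 1"
    using H \<alpha> by (simp_all add: powr_less_one)
  have "summable (\<lambda>n. prob (A n))"
  proof (rule summable_comparison_test)
    show "\<exists>N. \<forall>n\<ge>N. norm (prob (A n)) \<le> C * (2 powr - (H * \<alpha> / 2)) ^ n"
      using le by simp
    show "summable (\<lambda>n. C * (2 powr - (H * \<alpha> / 2)) ^ n)"
      using q by (intro summable_mult summable_geometric) simp
  qed
  then have "AE \<omega> in P. eventually (\<lambda>n. \<omega> \<in> space P - A n) sequentially"
    by (intro borel_cantelli_AE1) (auto simp: emeasure_eq_measure)
  then show ?thesis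
  proof eventually_elim
    case (elim \<omega>)
    have "(\<lambda>n. X (dyadic n (dyadic_floor n s)) \<omega> - X s \<omega>) \<longlonglongrightarrow> 0"
    proof (rule Lim_null_comparison)
      show "\<forall>\<^sub>F n in sequentially. norm (X (dyadic n (dyadic_floor n s)) \<omega> - X s \<omega>) \<le> x n"
        using elim by eventually_elim (auto simp: A_def not_less)
      show "x \<longlonglongrightarrow> 0"
        unfolding x_def using q by (intro LIMSEQ_power_zero) simp
    qed
    then show ?case by (simp add: LIM_zero_iff)
  qed
qed

text \<open>By self-similarity the increments of level \<open>n\<close> are those of the lattice field scaled by \<open>2\<^sup>-\<^sup>n\<^sup>H\<close>. A
union bound over the \<open>O(2\<^sup>n\<^sup>p)\<close> classes costs exactly the factor that the exponent \<open>H - p / \<alpha>\<close>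
compensates, and \<open>\<delta> > 1 / \<alpha>\<close> makes what remains, a multiple of \<open>n\<^sup>-\<^sup>\<alpha>\<^sup>\<delta>\<close>, summable.\<close>

lemma dyadic_increments_bound:
  fixes S :: "'s measure" and \<phi> :: "int ^ 'd \<Rightarrow> 's \<Rightarrow> 's"
  assumes dim: "has_effective_dimension \<alpha> P (increment_field X v) S \<phi> R N p" and \<delta>: "1 / \<alpha> < \<delta>"
  shows "AE \<omega> in P. \<forall>\<^sub>F n in sequentially. \<forall>t\<in>grid n.
    \<bar>X (dyadic n (t + v)) \<omega> - X (dyadic n t) \<omega>\<bar> \<le> 2 powr - (real n * (H - real p / \<alpha>)) * real n powr \<delta>"
proof -
  obtain \<kappa> :: "int ^ 'd \<Rightarrow> ('d \<Rightarrow> bool) \<times> int list \<times> ('s \<Rightarrow> 's)" and K :: nat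
    where \<kappa>: "\<forall>t u. \<kappa> t = \<kappa> u \<longrightarrow> (AE \<omega> in P. increment_field X v t \<omega> = increment_field X v u \<omega>)"
    and K: "\<forall>n. card (\<kappa> ` grid n) \<le> K * 2 ^ (n * p)"
    using generated_field_classes[OF dim \<alpha>] .
  obtain C where C: "0 \<le> C" "\<forall>x>0. prob {\<omega> \<in> space P. x < \<bar>X (vec_of_int v) \<omega> - X 0 \<omega>\<bar>} \<le> C * x powr - \<alpha>"
    using sas_increment_tail[OF sas \<alpha>, of "vec_of_int v" 0] .
  define a where "a n = 2 powr - (real n * (H - real p / \<alpha>)) * real n powr \<delta>" for n
  define A where "A n = {\<omega> \<in> space P. \<exists>t\<in>grid n. a n < \<bar>X (dyadic n (t + v)) \<omega> - X (dyadic n t) \<omega>\<bar>}" for n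
  have A[measurable]: "A n \<in> events" for n
    unfolding A_def by (intro sets.sets_Collect_finite_Ex finite_grid) simp
  have le: "prob (A n) \<le> real K * C * real n powr (- \<alpha> * \<delta>)" if n: "1 \<le> n" for n
  proof -
    define c :: real where "c = 1 / 2 ^ n"
    define y where "y = a n / c powr H"
    have y: "0 < y" using n by (simp add: y_def a_def c_def)
    have "prob (A n) = prob {\<omega> \<in> space P. \<exists>(a', b)\<in>(\<lambda>t. (vec_of_int (t + v), vec_of_int t)) ` grid n.
        a n < \<bar>X (c *\<^sub>R a') \<omega> - X (c *\<^sub>R b) \<omega>\<bar>}"
      by (simp add: A_def dyadic_def c_def)
    also have "\<dots> = prob {\<omega> \<in> space P. \<exists>t\<in>grid n. y < \<bar>increment_field X v t \<omega>\<bar>}"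
      by (subst scaled_increments) (simp_all add: finite_grid y_def increment_field_def c_def)
    also have "\<dots> \<le> card (\<kappa> ` grid n) * (C * y powr - \<alpha>)"
    proof (rule prob_Ex_le_classes[OF finite_grid])
      fix t
      show "random_variable borel (increment_field X v t)"
        unfolding increment_field_def[abs_def] by simp
      show "prob {\<omega> \<in> space P. y < \<bar>increment_field X v t \<omega>\<bar>} \<le> C * y powr - \<alpha>"
        unfolding increment_field_def vec_of_int_add stationary_increment_law[OF si] by (rule C(2)[rule_format, OF y])
    qed (use \<kappa> in blast)
    also have "\<dots> \<le> real (K * 2 ^ (n * p)) * (C * y powr - \<alpha>)"
      using K[rule_format, of n] C by (intro mult_right_mono) (simp_all del: of_nat_mult)
    also have "y powr - \<alpha> = 2 powr - (real n * real p) * real n powr (- \<alpha> * \<delta>)"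
    proof -
      have cH: "c powr H = 2 powr - (real n * H)"
        by (simp add: c_def powr_minus_divide powr_powr powr_realpow[symmetric] powr_divide)
      have "y = 2 powr - (real n * (H - real p / \<alpha>)) / 2 powr - (real n * H) * real n powr \<delta>"
        by (simp add: y_def a_def cH)
      also have "2 powr - (real n * (H - real p / \<alpha>)) / 2 powr - (real n * H) =
          (2 :: real) powr (- (real n * (H - real p / \<alpha>)) - - (real n * H))"
        by (rule powr_diff[symmetric])
      also have "- (real n * (H - real p / \<alpha>)) - - (real n * H) = real n * real p / \<alpha>"
        by (simp add: algebra_simps)
      finally have "y powr - \<alpha> = (2 powr (real n * real p / \<alpha>)) powr - \<alpha> * (real n powr \<delta>) powr - \<alpha>"
        by (simp add: powr_mult)
      then show ?thesis using \<alpha> by (simp add: powr_powr mult.commute)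
    qed
    also have "real (K * 2 ^ (n * p)) * (C * (2 powr - (real n * real p) * real n powr (- \<alpha> * \<delta>))) =
        real K * C * real n powr (- \<alpha> * \<delta>)"
      by (simp add: powr_realpow[symmetric] powr_minus_divide)
    finally show ?thesis .
  qed
  have "summable (\<lambda>n. prob (A n))"
  proof (rule summable_comparison_test)
    show "\<exists>N. \<forall>n\<ge>N. norm (prob (A n)) \<le> real K * C * real n powr (- \<alpha> * \<delta>)"
      using le by (intro exI[of _ 1]) auto
    have "1 < \<alpha> * \<delta>" using \<delta> \<alpha> by (simp add: field_simps)
    then show "summable (\<lambda>n. real K * C * real n powr (- \<alpha> * \<delta>))"
      by (intro summable_mult) (simp add: summable_real_powr_iff)
  qed
  then have "AE \<omega> in P. eventually (\<lambda>n. \<omega> \<in> space P - A n) sequentially"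
    by (intro borel_cantelli_AE1) (auto simp: emeasure_eq_measure)
  then show ?thesis
    by eventually_elim (auto simp: A_def a_def not_less elim!: eventually_mono)
qed

end

section \<open>Chaining and the modulus of continuity\<close>

lemma directionsI:
  assumes "\<And>j. \<bar>v $ j\<bar> \<le> 1" "v \<noteq> 0"
  shows "v \<in> directions"
proof -
  have "v $ j \<in> {-1, 0, 1}" for j using assms(1)[of j] by auto
  then show ?thesis using assms(2) by (simp add: directions_def)
qed

lemma dyadic_Suc: "dyadic (Suc n) (t + t) = dyadic n t"
  by (simp add: dyadic_def vec_of_int_def vec_eq_iff)

lemma dyadic_floor_in_grid:
  assumes "\<And>j. \<bar>s $ j\<bar> \<le> 2"
  shows "dyadic_floor n s \<in> grid n"
proof -
  have "\<bar>\<lfloor>2 ^ n * s $ j\<rfloor>\<bar> \<le> 2 ^ (n + 1)" for j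
  proof -
    define z where "z = 2 ^ n * s $ j"
    have "\<bar>z\<bar> \<le> 2 ^ n * 2"
      using assms[of j] by (simp add: z_def abs_mult)
    then have "z \<le> of_int (2 ^ (n + 1))" "of_int (- (2 ^ (n + 1))) \<le> z"
      by (simp_all add: abs_le_iff)
    then have "\<lfloor>z\<rfloor> \<le> 2 ^ (n + 1)" "- (2 ^ (n + 1)) \<le> \<lfloor>z\<rfloor>"
      using floor_mono[of z "of_int (2 ^ (n + 1))"] by (simp_all only: floor_of_int le_floor_iff)
    then show ?thesis by (simp add: z_def abs_le_iff)
  qed
  then show ?thesis by (simp add: grid_def dyadic_floor_def)
qed

lemma dyadic_floor_Suc:
  "\<bar>(dyadic_floor (Suc n) s - (dyadic_floor n s + dyadic_floor n s)) $ j\<bar> \<le> 1"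
proof -
  define y where "y = 2 ^ n * s $ j"
  have "\<lfloor>2 * y\<rfloor> = 2 * \<lfloor>y\<rfloor> \<or> \<lfloor>2 * y\<rfloor> = 2 * \<lfloor>y\<rfloor> + 1" by linarith
  then show ?thesis by (auto simp: dyadic_floor_def y_def mult.assoc)
qed

lemma dyadic_floor_neighbour:
  assumes "\<And>j. \<bar>s $ j - s' $ j\<bar> \<le> 1 / 2 ^ n"
  shows "\<bar>(dyadic_floor n s - dyadic_floor n s') $ j\<bar> \<le> 1"
proof -
  have "\<bar>2 ^ n * s $ j - 2 ^ n * s' $ j\<bar> = 2 ^ n * \<bar>s $ j - s' $ j\<bar>"
    by (simp add: right_diff_distrib[symmetric] abs_mult)
  also have "\<dots> \<le> 1" using assms[of j] by (simp add: field_simps)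
  finally have "\<bar>\<lfloor>2 ^ n * s $ j\<rfloor> - \<lfloor>2 ^ n * s' $ j\<rfloor>\<bar> \<le> 1" by linarith
  then show ?thesis by (simp add: dyadic_floor_def)
qed

lemma open_coordinate_cube: "open {s :: real ^ 'd. \<forall>j. \<bar>s $ j - c $ j\<bar> < r}"
proof -
  have "{s :: real ^ 'd. \<forall>j. \<bar>s $ j - c $ j\<bar> < r} = (\<Inter>j. {s. \<bar>s $ j - c $ j\<bar> < r})"
    by auto
  moreover have "open {s :: real ^ 'd. \<bar>s $ j - c $ j\<bar> < r}" for j
    by (intro open_Collect_less continuous_intros)
  ultimately show ?thesis by (auto intro!: open_INT)
qed

text \<open>A sample path argument. The dyadic approximants of a point at consecutive levels, and those of two
close points at the same level, are neighbours on a grid. The geometric series of the levels from \<open>n\<close> on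
contributes at most \<open>a n / (1 - q)\<close> for either point, and the link between them no more than that.\<close>

lemma separable_chaining:
  fixes x :: "real ^ 'd \<Rightarrow> real" and a :: "nat \<Rightarrow> real"
  assumes level: "\<And>n t v. n0 \<le> n \<Longrightarrow> t \<in> grid n \<Longrightarrow> v \<in> directions \<Longrightarrow>
      \<bar>x (dyadic n (t + v)) - x (dyadic n t)\<bar> \<le> a n"
    and a: "\<And>n. 0 \<le> a n" "\<And>n. n0 \<le> n \<Longrightarrow> a (Suc n) \<le> q * a n" and q: "0 \<le> q" "q < 1"
    and dense: "\<And>s. s \<in> D \<Longrightarrow> (\<lambda>n. x (dyadic n (dyadic_floor n s))) \<longlonglongrightarrow> x s"
    and sep: "\<And>G C. open G \<Longrightarrow> closed C \<Longrightarrow> (\<And>t. t \<in> G \<inter> D \<Longrightarrow> x t \<in> C) \<Longrightarrow> (\<And>t. t \<in> G \<Longrightarrow> x t \<in> C)"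
    and n: "n0 \<le> n" and ts: "t \<in> cbox 0 1" "s \<in> cbox 0 1" "\<And>j. \<bar>t $ j - s $ j\<bar> < 1 / 2 ^ n"
  shows "\<bar>x t - x s\<bar> \<le> 3 / (1 - q) * a n"
proof -
  define \<pi> where "\<pi> n s = dyadic n (dyadic_floor n s)" for n and s :: "real ^ 'd"
  have level0: "\<bar>x (dyadic k u) - x (dyadic k w)\<bar> \<le> a k"
    if "n0 \<le> k" "w \<in> grid k" "\<And>j. \<bar>(u - w) $ j\<bar> \<le> 1" for k u w
  proof (cases "u = w")
    case True then show ?thesis using a by simp
  next
    case False
    then have "u - w \<in> directions" using that by (intro directionsI) auto
    then show ?thesis using level[of k w "u - w"] that by simp
  qed
  have geo: "a (n + k) \<le> q ^ k * a n" for k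
  proof (induction k)
    case (Suc k)
    have "a (n + Suc k) \<le> q * a (n + k)" using a(2)[of "n + k"] n by simp
    also have "\<dots> \<le> q * (q ^ k * a n)" using Suc q by (intro mult_left_mono) auto
    finally show ?case by (simp add: mult.assoc)
  qed simp
  have chain: "\<bar>x (\<pi> (n + k) u) - x (\<pi> n u)\<bar> \<le> (\<Sum>i<k. q ^ i) * a n"
    if u: "\<And>j. \<bar>u $ j\<bar> \<le> 2" for u k
  proof (induction k)
    case (Suc k)
    define w where "w = dyadic_floor (n + k) u + dyadic_floor (n + k) u"
    have "\<bar>w $ j\<bar> \<le> 2 ^ (Suc (n + k) + 1)" for j
    proof -
      have "\<bar>dyadic_floor (n + k) u $ j\<bar> \<le> 2 ^ (n + k + 1)"
        using dyadic_floor_in_grid[of u "n + k"] u by (simp add: grid_def)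
      then have "\<bar>w $ j\<bar> \<le> 2 * 2 ^ (n + k + 1)"
        unfolding w_def vector_add_component by linarith
      then show ?thesis by simp
    qed
    then have "w \<in> grid (Suc (n + k))"
      by (simp add: grid_def)
    then have "\<bar>x (\<pi> (Suc (n + k)) u) - x (dyadic (Suc (n + k)) w)\<bar> \<le> a (Suc (n + k))"
      unfolding \<pi>_def using n dyadic_floor_Suc[of "n + k" u] by (intro level0) (auto simp: w_def)
    also have "dyadic (Suc (n + k)) w = \<pi> (n + k) u"
      unfolding w_def \<pi>_def by (rule dyadic_Suc)
    also have "a (Suc (n + k)) \<le> q * a (n + k)" using a(2) n by simp
    also have "\<dots> \<le> 1 * (q ^ k * a n)"
      using q geo a by (intro mult_mono) auto
    finally show ?case using Suc by (simp add: distrib_right)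
  qed simp
  have tail: "\<bar>x u - x (\<pi> n u)\<bar> \<le> 1 / (1 - q) * a n" if u: "u \<in> D" "\<And>j. \<bar>u $ j\<bar> \<le> 2" for u
  proof (rule LIMSEQ_le_const2)
    show "(\<lambda>k. \<bar>x (\<pi> (n + k) u) - x (\<pi> n u)\<bar>) \<longlonglongrightarrow> \<bar>x u - x (\<pi> n u)\<bar>"
      using LIMSEQ_ignore_initial_segment[OF dense[OF u(1)], of n]
      by (intro tendsto_intros) (simp add: \<pi>_def add.commute)
    have "(\<Sum>i<k. q ^ i) \<le> 1 / (1 - q)" for k
      using q by (simp add: sum_gp_strict divide_right_mono)
    then show "\<exists>N. \<forall>k\<ge>N. \<bar>x (\<pi> (n + k) u) - x (\<pi> n u)\<bar> \<le> 1 / (1 - q) * a n"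
      using chain[of u] u a by (meson mult_right_mono order_trans)
  qed
  have onD: "\<bar>x u - x w\<bar> \<le> 3 / (1 - q) * a n"
    if u: "u \<in> D" "\<And>j. \<bar>u $ j\<bar> \<le> 2" and w: "w \<in> D" "\<And>j. \<bar>w $ j\<bar> \<le> 2"
      and uw: "\<And>j. \<bar>u $ j - w $ j\<bar> \<le> 1 / 2 ^ n" for u w
  proof -
    have "\<bar>x (\<pi> n u) - x (\<pi> n w)\<bar> \<le> a n"
      unfolding \<pi>_def using n w uw by (intro level0 dyadic_floor_in_grid dyadic_floor_neighbour) auto
    also have "a n \<le> 1 / (1 - q) * a n"
      using q a mult_right_mono[of 1 "1 / (1 - q)" "a n"] by simp
    finally have "\<bar>x u - x w\<bar> \<le> 3 * (1 / (1 - q) * a n)"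
      using tail[OF u] tail[OF w] by linarith
    then show ?thesis by simp
  qed
  define K where "K = 3 / (1 - q) * a n"
  define cube where "cube = {u :: real ^ 'd. \<forall>j. \<bar>u $ j\<bar> < 2}"
  have cube: "open cube" using open_coordinate_cube[of 0 2] by (simp add: cube_def)
  have "u \<in> cube" if "u \<in> cbox 0 1" for u
  proof -
    have "0 \<le> u $ j \<and> u $ j \<le> 1" for j using that by (simp add: mem_box_cart)
    then have "\<bar>u $ j\<bar> < 2" for j by (smt (verit))
    then show ?thesis by (simp add: cube_def)
  qed
  then have in_cube: "t \<in> cube" "s \<in> cube" using ts by auto
  \<comment> \<open>Separability is applied twice, first with the points near \<open>s\<close> for a fixed point \<open>u\<close> of \<open>D\<close>, then with
    the points \<open>u\<close> near \<open>t\<close>.\<close>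
  have near_s: "x s \<in> {y. \<bar>x u - y\<bar> \<le> K}"
    if u: "u \<in> (cube \<inter> {u. \<forall>j. \<bar>u $ j - s $ j\<bar> < 1 / 2 ^ n}) \<inter> D" for u
  proof (rule sep)
    show "open (cube \<inter> {w. \<forall>j. \<bar>w $ j - u $ j\<bar> < 1 / 2 ^ n})"
      by (intro open_Int cube open_coordinate_cube)
    show "closed {y. \<bar>x u - y\<bar> \<le> K}" by (intro closed_Collect_le continuous_intros)
    show "s \<in> cube \<inter> {w. \<forall>j. \<bar>w $ j - u $ j\<bar> < 1 / 2 ^ n}"
      using u in_cube by (simp add: abs_minus_commute)
    fix w assume w: "w \<in> (cube \<inter> {w. \<forall>j. \<bar>w $ j - u $ j\<bar> < 1 / 2 ^ n}) \<inter> D"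
    have "\<bar>x u - x w\<bar> \<le> 3 / (1 - q) * a n"
      using u w by (intro onD) (auto simp: cube_def abs_minus_commute less_imp_le)
    then show "x w \<in> {y. \<bar>x u - y\<bar> \<le> K}" by (simp add: K_def)
  qed
  have "x t \<in> {y. \<bar>y - x s\<bar> \<le> K}"
  proof (rule sep)
    show "open (cube \<inter> {u. \<forall>j. \<bar>u $ j - s $ j\<bar> < 1 / 2 ^ n})"
      by (intro open_Int cube open_coordinate_cube)
    show "closed {y. \<bar>y - x s\<bar> \<le> K}" by (intro closed_Collect_le continuous_intros)
    show "t \<in> cube \<inter> {u. \<forall>j. \<bar>u $ j - s $ j\<bar> < 1 / 2 ^ n}" using in_cube ts by simp
  qed (use near_s in auto)
  then show ?thesis by (simp add: K_def)
qed

text \<open>The geometric decay that chaining requires. The exponent \<open>\<eta> / 2\<close> instead of \<open>\<eta>\<close> absorbs the growth of the polynomial factor.\<close>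

lemma powr_decay_ratio:
  assumes "0 < \<eta>"
  shows "\<forall>\<^sub>F n in sequentially. 2 powr - (real (Suc n) * \<eta>) * real (Suc n) powr \<delta> \<le>
    2 powr - (\<eta> / 2) * (2 powr - (real n * \<eta>) * real n powr \<delta>)"
proof -
  have "(\<lambda>n. (1 + 1 / real n) powr \<delta>) \<longlonglongrightarrow> (1 + 0) powr \<delta>"
    by (intro tendsto_intros lim_1_over_n) auto
  moreover have "(1 + 0 :: real) powr \<delta> < 2 powr (\<eta> / 2)"
    using assms by simp
  ultimately have "\<forall>\<^sub>F n in sequentially. (1 + 1 / real n) powr \<delta> < 2 powr (\<eta> / 2)"
    by (rule order_tendstoD(2))
  then show ?thesis
    using eventually_gt_at_top[of 0]
  proof eventually_elim
    case (elim n)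
    have "real (Suc n) = (1 + 1 / real n) * real n"
      using elim by (simp add: field_simps)
    then have "real (Suc n) powr \<delta> = ((1 + 1 / real n) * real n) powr \<delta>"
      by (rule arg_cong)
    also have "\<dots> = (1 + 1 / real n) powr \<delta> * real n powr \<delta>"
      by (simp add: powr_mult)
    also have "\<dots> \<le> 2 powr (\<eta> / 2) * real n powr \<delta>"
      using elim by (intro mult_right_mono) auto
    finally have "2 powr - (real (Suc n) * \<eta>) * real (Suc n) powr \<delta> \<le>
        2 powr - (real (Suc n) * \<eta>) * (2 powr (\<eta> / 2) * real n powr \<delta>)"
      by (intro mult_left_mono) auto
    also have "\<dots> = (2 powr - (real (Suc n) * \<eta>) * 2 powr (\<eta> / 2)) * real n powr \<delta>"
      by simp
    also have "2 powr - (real (Suc n) * \<eta>) * 2 powr (\<eta> / 2) = 2 powr - (\<eta> / 2) * 2 powr - (real n * \<eta>)"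
      unfolding powr_add[symmetric] by (rule arg_cong[where f="\<lambda>z. 2 powr z"]) (simp add: field_simps)
    finally show ?case by (simp only: mult.assoc)
  qed
qed

lemma dyadic_scale:
  fixes h :: real
  assumes "0 < h" "h < 1 / 2 ^ n0"
  obtains n where "n0 \<le> n" "h < 1 / 2 ^ n" "1 / 2 ^ n \<le> 2 * h"
proof -
  obtain m where m: "(1 / 2) ^ m < h"
    using real_arch_pow_inv[OF assms(1), of "1 / 2"] by auto
  define k where "k = (LEAST k. 1 / 2 ^ k \<le> h)"
  have k: "1 / 2 ^ k \<le> h"
    unfolding k_def by (rule LeastI[of "\<lambda>k. 1 / 2 ^ k \<le> h" m]) (use m in \<open>simp add: power_one_over\<close>)
  have least: "h < 1 / 2 ^ i" if "i < k" for i
    using not_less_Least[of i "\<lambda>k. 1 / 2 ^ k \<le> h"] that by (simp add: k_def)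
  have "n0 < k"
  proof (rule ccontr)
    assume "\<not> n0 < k"
    then have "(1 / 2 :: real) ^ n0 \<le> (1 / 2) ^ k" by (intro power_decreasing) auto
    then show False using k assms(2) by (simp add: power_one_over)
  qed
  then obtain n where n: "k = Suc n" "n0 \<le> n" by (cases k) auto
  show ?thesis using that[of n] n least[of n] k by simp
qed

text \<open>For small \<open>h\<close> choose \<open>n\<close> with \<open>h < 2\<^sup>-\<^sup>n \<le> 2 h\<close>. Then \<open>n \<le> ln (1 / h) / ln 2\<close>, and the modulus at level \<open>n\<close>
is at most a multiple of \<open>h\<^sup>\<eta> ln(1/h)\<^sup>\<delta>\<close>.\<close>

lemma modulus_Limsup_eq_0:
  fixes x :: "real ^ 'd \<Rightarrow> real"
  assumes K: "0 \<le> K" and \<eta>: "0 < \<eta>" and \<delta>: "0 < \<delta>" "\<delta> < \<beta>"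
    and mod: "\<And>n t s. n0 \<le> n \<Longrightarrow> t \<in> cbox 0 1 \<Longrightarrow> s \<in> cbox 0 1 \<Longrightarrow> (\<And>j. \<bar>t $ j - s $ j\<bar> < 1 / 2 ^ n) \<Longrightarrow>
      \<bar>x t - x s\<bar> \<le> K * (2 powr - (real n * \<eta>) * real n powr \<delta>)"
  shows "Limsup (at_right 0) (\<lambda>h :: real.
    (SUP t \<in> cbox 0 1. SUP s \<in> {s \<in> cbox 0 1. (MAX j. \<bar>s $ j - t $ j\<bar>) \<le> h}. ereal \<bar>x t - x s\<bar>)
    / ereal (h powr \<eta> * ln (1 / h) powr \<beta>)) = 0"
proof -
  define F where "F h = (SUP t \<in> cbox 0 1. SUP s \<in> {s \<in> cbox 0 1. (MAX j. \<bar>s $ j - t $ j\<bar>) \<le> h}. ereal \<bar>x t - x s\<bar>)"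
    for h :: real
  define K' where "K' = K * (2 powr \<eta> * (1 / ln 2) powr \<delta>)"
  have upper: "F h \<le> ereal (K' * (h powr \<eta> * ln (1 / h) powr \<delta>))" if h: "0 < h" "h < 1 / 2 ^ n0" for h
  proof -
    obtain n where n: "n0 \<le> n" "h < 1 / 2 ^ n" "1 / 2 ^ n \<le> 2 * h"
      using dyadic_scale[OF h] .
    have "2 powr - (real n * \<eta>) = (1 / 2 ^ n) powr \<eta>"
      by (simp add: powr_minus_divide powr_powr powr_realpow[symmetric] powr_divide)
    also have "\<dots> \<le> (2 * h) powr \<eta>"
      using n \<eta> by (intro powr_mono2) auto
    finally have 1: "2 powr - (real n * \<eta>) \<le> 2 powr \<eta> * h powr \<eta>"
      using h by (simp add: powr_mult)
    have "2 ^ n < 1 / h" using n h by (simp add: field_simps)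
    then have "ln (2 ^ n) < ln (1 / h)" using h by (subst ln_less_cancel_iff) auto
    then have "real n \<le> ln (1 / h) * (1 / ln 2)"
      by (simp add: ln_realpow field_simps)
    then have "real n powr \<delta> \<le> (ln (1 / h) * (1 / ln 2)) powr \<delta>"
      using \<delta> by (intro powr_mono2) auto
    also have "\<dots> = ln (1 / h) powr \<delta> * (1 / ln 2) powr \<delta>"
      by (rule powr_mult)
    finally have 2: "real n powr \<delta> \<le> ln (1 / h) powr \<delta> * (1 / ln 2) powr \<delta>" .
    have "K * (2 powr - (real n * \<eta>) * real n powr \<delta>) \<le>
        K * ((2 powr \<eta> * h powr \<eta>) * (ln (1 / h) powr \<delta> * (1 / ln 2) powr \<delta>))"
      using K by (intro mult_left_mono mult_mono 1 2) auto
    also have "\<dots> = K' * (h powr \<eta> * ln (1 / h) powr \<delta>)"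
      by (simp add: K'_def)
    finally have 3: "K * (2 powr - (real n * \<eta>) * real n powr \<delta>) \<le> K' * (h powr \<eta> * ln (1 / h) powr \<delta>)" .
    show ?thesis
      unfolding F_def
    proof (intro SUP_least)
      fix t s assume t: "t \<in> cbox (0 :: real ^ 'd) 1"
        and s: "s \<in> {s \<in> cbox 0 1. (MAX j. \<bar>s $ j - t $ j\<bar>) \<le> h}"
      have "\<bar>s $ j - t $ j\<bar> \<le> (MAX j. \<bar>s $ j - t $ j\<bar>)" for j
        by (intro Max_ge) auto
      then have "\<bar>t $ j - s $ j\<bar> < 1 / 2 ^ n" for j
        using s n(2) by (simp add: abs_minus_commute) (meson le_less_trans)
      then have "\<bar>x t - x s\<bar> \<le> K * (2 powr - (real n * \<eta>) * real n powr \<delta>)"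
        using s t n(1) by (intro mod) auto
      then show "ereal \<bar>x t - x s\<bar> \<le> ereal (K' * (h powr \<eta> * ln (1 / h) powr \<delta>))"
        using 3 by simp
    qed
  qed
  have lower: "0 \<le> F h" if "0 < h" for h
    unfolding F_def using that
    by (intro SUP_upper2[where i="0 :: real ^ 'd"]) (auto simp: mem_box_cart)
  have small: "\<forall>\<^sub>F h in at_right 0. 0 < h \<and> h < 1 / 2 ^ n0 \<and> h < (1 :: real)"
    unfolding eventually_at_right_field by (intro exI[of _ "1 / 2 ^ n0"]) (auto intro: less_le_trans)
  have "((\<lambda>h. F h / ereal (h powr \<eta> * ln (1 / h) powr \<beta>)) \<longlongrightarrow> 0) (at_right 0)"
  proof (rule tendsto_sandwich)
    show "\<forall>\<^sub>F h in at_right 0. 0 \<le> F h / ereal (h powr \<eta> * ln (1 / h) powr \<beta>)"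
      using small
    proof eventually_elim
      case (elim h)
      then have "0 < h powr \<eta> * ln (1 / h) powr \<beta>" by simp
      then show ?case using lower[of h] elim by (intro zero_le_divide_ereal) auto
    qed
    show "\<forall>\<^sub>F h in at_right 0. F h / ereal (h powr \<eta> * ln (1 / h) powr \<beta>) \<le> ereal (K' * ln (1 / h) powr (\<delta> - \<beta>))"
      using small
    proof eventually_elim
      case (elim h)
      then have l: "0 < ln (1 / h)" by simp
      have "F h / ereal (h powr \<eta> * ln (1 / h) powr \<beta>) \<le>
          ereal (K' * (h powr \<eta> * ln (1 / h) powr \<delta>)) / ereal (h powr \<eta> * ln (1 / h) powr \<beta>)"
        using elim l by (intro ereal_divide_right_mono upper) auto
      also have "\<dots> = ereal (K' * ln (1 / h) powr (\<delta> - \<beta>))"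
        using elim l by (simp add: powr_diff)
      finally show ?case .
    qed
    have "((\<lambda>h. K' * ln (1 / h) powr (\<delta> - \<beta>)) \<longlongrightarrow> 0) (at_right 0)"
    proof (rule tendsto_mult_right_zero)
      have "filterlim (\<lambda>h :: real. ln (1 / h)) at_top (at_right 0)"
        using filterlim_compose[OF ln_at_top filterlim_inverse_at_top_right] by (simp add: inverse_eq_divide)
      then show "((\<lambda>h :: real. ln (1 / h) powr (\<delta> - \<beta>)) \<longlongrightarrow> 0) (at_right 0)"
        using \<delta> by (intro tendsto_neg_powr) auto
    qed
    then show "((\<lambda>h. ereal (K' * ln (1 / h) powr (\<delta> - \<beta>))) \<longlongrightarrow> 0) (at_right 0)"
      by (simp add: zero_ereal_def)
  qed simp
  then show ?thesis
    unfolding F_def by (intro lim_imp_Limsup) auto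
qed

theorem corollary4p3:
  fixes \<alpha> H \<gamma> :: real and p :: nat
    and P :: "'w measure" and X :: "real ^ 'd \<Rightarrow> 'w \<Rightarrow> real"
    and Q :: "'v measure" and m :: "'e measure" and M :: "'e set \<Rightarrow> 'v \<Rightarrow> real"
    and f :: "real ^ 'd \<Rightarrow> 'e \<Rightarrow> real"
    and S :: "int ^ 'd \<Rightarrow> 's measure" and \<phi> :: "int ^ 'd \<Rightarrow> int ^ 'd \<Rightarrow> 's \<Rightarrow> 's"
    and R :: "int ^ 'd \<Rightarrow> 'u measure" and N :: "int ^ 'd \<Rightarrow> 's set \<Rightarrow> 'u \<Rightarrow> real"
  assumes "0 < \<alpha>" and "\<alpha> < 2" and "0 < H"
    and "sas_field \<alpha> P X"
    and "self_similar H P X"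
    and "stationary_increments P X"
    and "separable_field P X"
    and "stable_integral_representation \<alpha> P X Q m M f"
    and "\<And>v. v \<in> directions \<Longrightarrow>
           has_effective_dimension \<alpha> P (increment_field X v) (S v) (\<phi> v) (R v) (N v) p"
    and "p \<le> CARD('d)"
    and "\<alpha> > real p / H"
    and "0 < \<gamma>" and "\<gamma> < \<alpha>"
  shows "AE \<omega> in P.
           Limsup (at_right 0) (\<lambda>h :: real.
             (SUP t \<in> cbox 0 1. SUP s \<in> {s \<in> cbox 0 1. (MAX j. \<bar>s $ j - t $ j\<bar>) \<le> h}.
                ereal \<bar>X t \<omega> - X s \<omega>\<bar>)
             / ereal (h powr (H - real p / \<alpha>) * ln (1 / h) powr (1 / \<gamma>))) = 0"
proof -
  have field: "self_similar_stable_field \<alpha> H P X"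
    by (rule self_similar_stable_field.intro[OF assms(1,3,4,5,6)])
  interpret self_similar_stable_field \<alpha> H P X
    by (rule field)
  define \<eta> where "\<eta> = H - real p / \<alpha>"
  have "real p / \<alpha> < H"
    using assms(1,3,11) by (simp add: pos_divide_less_eq mult.commute)
  then have \<eta>: "0 < \<eta>" by (simp add: \<eta>_def)
  have "1 / \<alpha> < 1 / \<gamma>" using assms(12,13) by (simp add: field_simps)
  then obtain \<delta> where \<delta>: "1 / \<alpha> < \<delta>" "\<delta> < 1 / \<gamma>" using dense by blast
  have \<delta>0: "0 < \<delta>" using \<delta>(1) assms(1) by (meson less_trans zero_less_divide_1_iff)
  define a where "a n = 2 powr - (real n * \<eta>) * real n powr \<delta>" for n
  define q :: real where "q = 2 powr - (\<eta> / 2)"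
  have q: "0 \<le> q" "q < 1" using \<eta> by (simp_all add: q_def powr_less_one)
  obtain D where D: "countable D" and sep: "AE \<omega> in P. \<forall>G C. open G \<and> closed C \<and> (\<forall>t\<in>G \<inter> D. X t \<omega> \<in> C) \<longrightarrow> (\<forall>t\<in>G. X t \<omega> \<in> C)"
    using assms(7) unfolding separable_field_def by blast
  have "(directions :: (int ^ 'd) set) \<subseteq> grid 0"
  proof
    fix v :: "int ^ 'd" assume "v \<in> directions"
    then have "v $ j \<in> {-1, 0, 1}" for j by (simp add: directions_def)
    then have "\<bar>v $ j\<bar> \<le> 2" for j by (smt (verit) insert_iff singletonD)
    then show "v \<in> grid 0" by (simp add: grid_def)
  qed
  then have fin: "finite (directions :: (int ^ 'd) set)"
    by (rule finite_subset[OF _ finite_grid])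
  then have level: "AE \<omega> in P. \<forall>v\<in>directions. \<forall>\<^sub>F n in sequentially. \<forall>t\<in>grid n.
      \<bar>X (dyadic n (t + v)) \<omega> - X (dyadic n t) \<omega>\<bar> \<le> a n"
    unfolding a_def \<eta>_def using dyadic_increments_bound[OF assms(9) \<delta>(1)] by (intro AE_finite_allI)
  have approx: "AE \<omega> in P. \<forall>s\<in>D. (\<lambda>n. X (dyadic n (dyadic_floor n s)) \<omega>) \<longlonglongrightarrow> X s \<omega>"
    using D dyadic_approximation by (simp add: AE_ball_countable)
  from sep level approx show ?thesis
  proof eventually_elim
    case (elim \<omega>)
    have "\<forall>\<^sub>F n in sequentially. \<forall>v\<in>directions. \<forall>t\<in>grid n.
        \<bar>X (dyadic n (t + v)) \<omega> - X (dyadic n t) \<omega>\<bar> \<le> a n"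
      using elim(2) fin by (simp add: eventually_ball_finite)
    then have "\<forall>\<^sub>F n in sequentially. (\<forall>v\<in>directions. \<forall>t\<in>grid n.
        \<bar>X (dyadic n (t + v)) \<omega> - X (dyadic n t) \<omega>\<bar> \<le> a n) \<and> a (Suc n) \<le> q * a n"
      using powr_decay_ratio[OF \<eta>, of \<delta>] unfolding a_def q_def by (rule eventually_conj)
    then obtain n0 where n0: "\<And>n. n0 \<le> n \<Longrightarrow> (\<forall>v\<in>directions. \<forall>t\<in>grid n.
        \<bar>X (dyadic n (t + v)) \<omega> - X (dyadic n t) \<omega>\<bar> \<le> a n) \<and> a (Suc n) \<le> q * a n"
      unfolding eventually_sequentially by blast
    show ?case
      unfolding \<eta>_def[symmetric]
    proof (rule modulus_Limsup_eq_0[OF _ \<eta> \<delta>0 \<delta>(2)])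
      show "0 \<le> 3 / (1 - q)" using q by simp
      fix n and t s :: "real ^ 'd" assume n: "n0 \<le> n" and ts: "t \<in> cbox 0 1" "s \<in> cbox 0 1" "\<And>j. \<bar>t $ j - s $ j\<bar> < 1 / 2 ^ n"
      have "\<bar>X t \<omega> - X s \<omega>\<bar> \<le> 3 / (1 - q) * a n"
      proof (rule separable_chaining[where x="\<lambda>t. X t \<omega>" and a=a and n=n and n0=n0 and D=D])
        show "X t \<omega> \<in> C" if "open G" "closed C" "\<And>t. t \<in> G \<inter> D \<Longrightarrow> X t \<omega> \<in> C" "t \<in> G" for G C t
          using elim(1) that by blast
        show "0 \<le> a n" for n by (simp add: a_def)
      qed (use n0 elim(3) q n ts in auto)
      then show "\<bar>X t \<omega> - X s \<omega>\<bar> \<le> 3 / (1 - q) * (2 powr - (real n * \<eta>) * real n powr \<delta>)"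
        by (simp add: a_def)
    qed
  qed
qed

end
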